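(* Let $n\ge1$. The mirror singularity to $(P\in Y)=\big(0\in\{xz=y(y+t^n)\}\subset\mathbb{A}^4_{x,y,z,t}\big)$, namely $Y^\star=\operatorname{Spec}\mathbb{C}[\vartheta_q:q\in\sigma\cap\mathbb{Z}^3]$ as defined in the context, is the nonisolated affine 3-fold singularity $$(P^\star\in Y^\star)=\big(0\in\mathbb{V}(I)\subset\mathbb{A}^{n+3}_{\vartheta_1,\dots,\vartheta_{n+3}}\big),$$ where $I$ is the ideal of codimension $n$ defined by the $2\times2$ minors of the $2\times(n+1)$ matrix $$\begin{pmatrix}\vartheta_1+\vartheta_2&\vartheta_3&\vartheta_4&\cdots&\vartheta_{n+1}&\vartheta_{n+2}\\ \vartheta_1\vartheta_2&\vartheta_4&\vartheta_5&\cdots&\vartheta_{n+2}&\vartheta_{n+3}\end{pmatrix}.$$ Here the coordinates are the theta functions $\vartheta_1=\vartheta_{(1,1,0)}$, $\vartheta_2=\vartheta_{(0,1,0)}$, $\vartheta_3=\vartheta_{(0,0,1)}$ and $\vartheta_{i+3}=\vartheta_{(i,i,1)}$ for $i=1,\dots,n$.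
   Context: Let $\sigma=\{(a,b,c)\in\mathbb{R}^3:a\ge0,\ c\ge0,\ a\le2b,\ a\le b+nc\}$; this is the cone in the tropicalisation $U^{\mathrm{trop}}$ (underlying manifold $\mathbb{R}^3$, integral points $\mathbb{Z}^3$) of $U=Y\setminus\{yt=0\}$ associated to $Y$. The mirror $V$ of $U$ is a cluster variety containing a torus $(\mathbb{C}^\times)^3_{u,v,w}$; for $(a,b,c)\in\mathbb{Z}^3$ the theta function $\vartheta_{(a,b,c)}\in\mathbb{C}[V]\subset\mathbb{C}[u^{\pm1},v^{\pm1},w^{\pm1}]$ is $$\vartheta_{(a,b,c)}=\begin{cases}u^av^bw^c&\text{if }b-nc\le0,\\ u^av^bw^c(1+u)^{b-nc}&\text{if }b-nc\ge0.\end{cases}$$ The mirror singularity is $Y^\star=\operatorname{Spec}\mathbb{C}[Y^\star]$, where $\mathbb{C}[Y^\star]=\mathbb{C}[\vartheta_q:q\in\sigma\cap\mathbb{Z}^3]$ is the $\mathbb{C}$-subalgebra of $\mathbb{C}[u^{\pm1},v^{\pm1},w^{\pm1}]$ generated by the theta functions of the integral points of $\sigma$. The points $(1,1,0),(0,1,0),(0,0,1)$ are the primitive generators of the rays of $\sigma$ in $U^{\mathrm{trop}}$, corresponding to the components $\{x=y=0\}$, $\{y=z=0\}$, $\{t=0,xz=y^2\}$ of $Y\setminus U$, and the points $(i,i,1)$, $i=1,\dots,n$, correspond to the exceptional divisors of Reid's pagoda resolution. *)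

theory Defs
  imports
    Complex_Main
    "HOL-Algebra.Algebra"
    "HOL-Algebra.Algebraic_Closure_Type"
    "HOL-Library.Poly_Mapping"
    "HOL-Library.Product_Plus"
    "HOL-Library.Function_Algebras"
    "HOL-Library.Extended_Nat"
begin

section \<open>Dimension theory\<close>

definition prime_chain :: "('a, 'b) ring_scheme \<Rightarrow> (nat \<Rightarrow> 'a set) \<Rightarrow> nat \<Rightarrow> bool"
  where "prime_chain R C k \<longleftrightarrow>
    (\<forall>i\<le>k. primeideal (C i) R) \<and> (\<forall>i<k. C i \<subset> C (Suc i))"

definition krull_dim :: "('a, 'b) ring_scheme \<Rightarrow> enat"
  where "krull_dim R = (SUP k\<in>{k. \<exists>C. prime_chain R C k}. enat k)"

definition prime_height :: "('a, 'b) ring_scheme \<Rightarrow> 'a set \<Rightarrow> enat"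
  where "prime_height R P = (SUP k\<in>{k. \<exists>C. prime_chain R C k \<and> C k = P}. enat k)"

definition ideal_codim :: "('a, 'b) ring_scheme \<Rightarrow> 'a set \<Rightarrow> enat"
  where "ideal_codim R I = (INF P\<in>{P. primeideal P R \<and> I \<subseteq> P}. prime_height R P)"


section \<open>Polynomials and subschemes of affine space\<close>

text \<open>A polynomial maps each monomial (an exponent vector, itself a finitely supported function
  on the indices of the variables) to its coefficient.  A point or tangent vector of affine
  \<open>N\<close>-space has its coordinates at the indices \<open>1, \<dots>, N\<close> and is \<open>0\<close> at all other indices.\<close>

type_synonym cpoly = "(nat \<Rightarrow>\<^sub>0 nat) \<Rightarrow>\<^sub>0 complex"

definition polynomial_ring :: "nat \<Rightarrow> cpoly ring"
  where "polynomial_ring N =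
    ring_of_type_algebra \<lparr>carrier := {f. \<forall>m\<in>Poly_Mapping.keys f. Poly_Mapping.keys m \<subseteq> {1..N}}\<rparr>"

definition scalar :: "complex \<Rightarrow> ('m::zero \<Rightarrow>\<^sub>0 complex)"
  where "scalar c = Poly_Mapping.single 0 c"

definition pvar :: "nat \<Rightarrow> cpoly"
  where "pvar i = Poly_Mapping.single (Poly_Mapping.single i 1) 1"

definition eval_at :: "(nat \<Rightarrow> complex) \<Rightarrow> cpoly \<Rightarrow> complex"
  where "eval_at p f = (\<Sum>m\<in>Poly_Mapping.keys f. Poly_Mapping.lookup f m *
    (\<Prod>i\<in>Poly_Mapping.keys m. p i ^ Poly_Mapping.lookup m i))"

definition partial_deriv :: "nat \<Rightarrow> cpoly \<Rightarrow> cpoly"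
  where "partial_deriv i f = (\<Sum>m\<in>Poly_Mapping.keys f.
    Poly_Mapping.single (m - Poly_Mapping.single i 1)
      (of_nat (Poly_Mapping.lookup m i) * Poly_Mapping.lookup f m))"

definition affine_space :: "nat \<Rightarrow> (nat \<Rightarrow> complex) set"
  where "affine_space N = {p. \<forall>i. i \<notin> {1..N} \<longrightarrow> p i = 0}"

definition zero_locus :: "nat \<Rightarrow> cpoly set \<Rightarrow> (nat \<Rightarrow> complex) set"
  where "zero_locus N S = {p \<in> affine_space N. \<forall>f\<in>S. eval_at p f = 0}"

text \<open>In the following, \<open>I\<close> is an ideal of the polynomial ring in \<open>N\<close> variables and \<open>p\<close> is a
  point of the closed subscheme of affine \<open>N\<close>-space defined by \<open>I\<close>.\<close>

definition tangent_space :: "nat \<Rightarrow> cpoly set \<Rightarrow> (nat \<Rightarrow> complex) \<Rightarrow> (nat \<Rightarrow> complex) set"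
  where "tangent_space N I p =
    {v \<in> affine_space N. \<forall>f\<in>I. (\<Sum>i=1..N. eval_at p (partial_deriv i f) * v i) = 0}"

definition tangent_dim :: "nat \<Rightarrow> cpoly set \<Rightarrow> (nat \<Rightarrow> complex) \<Rightarrow> nat"
  where "tangent_dim N I p =
    vector_space.dim (\<lambda>(c::complex) (v::nat \<Rightarrow> complex) i. c * v i) (tangent_space N I p)"

text \<open>The Krull dimension of the local ring at \<open>p\<close> is the height of the maximal ideal of \<open>p\<close> in
  the coordinate ring.\<close>

definition local_dim :: "nat \<Rightarrow> cpoly set \<Rightarrow> (nat \<Rightarrow> complex) \<Rightarrow> enat"
  where "local_dim N I p =
    prime_height (polynomial_ring N Quot I)
      {I +>\<^bsub>polynomial_ring N\<^esub> f | f. f \<in> carrier (polynomial_ring N) \<and> eval_at p f = 0}"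

text \<open>\<open>p\<close> is a regular point if its Zariski tangent space has the dimension of the local ring.\<close>

definition singular_locus :: "nat \<Rightarrow> cpoly set \<Rightarrow> (nat \<Rightarrow> complex) set"
  where "singular_locus N I =
    {p \<in> zero_locus N I. enat (tangent_dim N I p) \<noteq> local_dim N I p}"

text \<open>A singular point \<open>p\<close> is isolated if \<open>{p}\<close> is open in the singular locus; the Zariski open
  neighbourhoods of \<open>p\<close> are the complements of the zero loci not containing \<open>p\<close>.\<close>

definition isolated_singularity :: "nat \<Rightarrow> cpoly set \<Rightarrow> (nat \<Rightarrow> complex) \<Rightarrow> bool"
  where "isolated_singularity N I p \<longleftrightarrow> p \<in> singular_locus N I \<and>
    (\<exists>S \<subseteq> carrier (polynomial_ring N).
      p \<notin> zero_locus N S \<and> singular_locus N I - zero_locus N S = {p})"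

definition nonisolated_singularity :: "nat \<Rightarrow> cpoly set \<Rightarrow> (nat \<Rightarrow> complex) \<Rightarrow> bool"
  where "nonisolated_singularity N I p \<longleftrightarrow>
    p \<in> singular_locus N I \<and> \<not> isolated_singularity N I p"


section \<open>Theta functions and the mirror algebra\<close>

text \<open>The Laurent polynomial ring in \<open>u, v, w\<close> is the group algebra of the lattice of
  exponents \<open>(a, b, c)\<close>.\<close>

type_synonym laurent = "(int \<times> int \<times> int) \<Rightarrow>\<^sub>0 complex"

definition laurent_monom :: "int \<times> int \<times> int \<Rightarrow> laurent"
  where "laurent_monom q = Poly_Mapping.single q 1"

definition sigma_cone :: "nat \<Rightarrow> (real \<times> real \<times> real) set"
  where "sigma_cone n = {(a, b, c). a \<ge> 0 \<and> c \<ge> 0 \<and> a \<le> 2 * b \<and> a \<le> b + real n * c}"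

definition sigma_points :: "nat \<Rightarrow> (int \<times> int \<times> int) set"
  where "sigma_points n =
    {(a, b, c). (real_of_int a, real_of_int b, real_of_int c) \<in> sigma_cone n}"

definition theta :: "nat \<Rightarrow> int \<times> int \<times> int \<Rightarrow> laurent"
  where "theta n = (\<lambda>(a, b, c).
    if b - int n * c \<le> 0 then laurent_monom (a, b, c)
    else laurent_monom (a, b, c) * (1 + laurent_monom (1, 0, 0)) ^ nat (b - int n * c))"

text \<open>The \<open>\<complex>\<close>-subalgebra generated by a set is the subring generated by the set together with
  the scalars.\<close>

definition mirror_algebra :: "nat \<Rightarrow> laurent ring"
  where "mirror_algebra n = ring_of_type_algebra
    \<lparr>carrier := generate_ring ring_of_type_algebra (range scalar \<union> theta n ` sigma_points n)\<rparr>"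


section \<open>The determinantal ideal\<close>

text \<open>Rows are numbered \<open>1, 2\<close> and columns \<open>1, \<dots>, n + 1\<close>.\<close>

definition mirror_matrix :: "nat \<Rightarrow> nat \<Rightarrow> cpoly"
  where "mirror_matrix i j =
    (if j = 1 then (if i = 1 then pvar 1 + pvar 2 else pvar 1 * pvar 2)
     else (if i = 1 then pvar (j + 1) else pvar (j + 2)))"

definition minors :: "nat \<Rightarrow> cpoly set"
  where "minors n =
    {mirror_matrix 1 j * mirror_matrix 2 k - mirror_matrix 1 k * mirror_matrix 2 j | j k.
      1 \<le> j \<and> j < k \<and> k \<le> n + 1}"

definition minor_ideal :: "nat \<Rightarrow> cpoly set"
  where "minor_ideal n = Idl\<^bsub>polynomial_ring (n + 3)\<^esub> (minors n)"

end

theory Submission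
  imports
    Defs
    "HOL-Computational_Algebra.Polynomial"
    "HOL-Computational_Algebra.Fraction_Field"
begin

text \<open>Write \<open>x, y\<close> for the first two coordinates and \<open>z\<^sub>0, \<dots>, z\<^sub>n\<close> for the remaining ones.  The minors
  say that \<open>z\<^sub>0, \<dots>, z\<^sub>n\<close> is a geometric progression with ratio \<open>xy / (x + y)\<close>, so the variety is
  swept out by
  \<open>z\<^sub>i = (xy)\<^sup>i (x + y)\<^sup>n\<^sup>-\<^sup>i t\<close>
  with free parameters \<open>x, y, t\<close>.  Everything rests on the fact that the determinantal ideal is
  the whole kernel of this parametrisation (\<open>kernel_scroll_param_subset\<close>); in particular it is
  prime.  To see this, the quadratic minors among the \<open>z\<^sub>i\<close> allow every monomial in the \<open>z\<^sub>i\<close> to be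
  replaced by a standard one that depends only on its degree and on its weight (the sum of the
  indices), and a relation among the standard monomials of one degree is reduced, from the highest
  weight downwards, by the minors involving the first column
  (\<open>homogeneous_relation_in_minor_ideal\<close>).

  The theta functions satisfy the minors because \<open>\<vartheta>\<^sub>1 + \<vartheta>\<^sub>2 = v(1 + u)\<^sup>2\<close>, \<open>\<vartheta>\<^sub>1\<vartheta>\<^sub>2 = uv\<^sup>2(1 + u)\<^sup>2\<close> and
  \<open>\<vartheta>\<^sub>i\<^sub>+\<^sub>3 = (uv)\<^sup>i w\<close>.  Conversely \<open>u = x/y\<close>, \<open>v = y\<^sup>2/(x + y)\<close>, \<open>w = (x + y)\<^sup>n t\<close> turns the theta
  functions back into the parametrisation, so they satisfy no other relations
  (\<open>mirror_map_kernel_subset\<close>).  They generate the mirror algebra since \<open>v = \<vartheta>\<^sub>2 - uv\<close> and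
  \<open>u\<^sup>2v = \<vartheta>\<^sub>1 - uv\<close>, which makes every monomial, and then every theta function, of the cone a
  polynomial in them (\<open>theta_in_image\<close>).

  For the dimensions, two facts suffice: a prime chain in a polynomial ring in \<open>N\<close> variables has
  length at most \<open>N\<close> (\<open>prime_chain_polynomial_ring_length\<close>), and there is a prime chain of length
  \<open>n + 3\<close> whose \<open>n\<close>-th member is the determinantal ideal (\<open>flag_strict\<close>).  Concatenating chains below and
  above the ideal then gives codimension \<open>n\<close> and dimension \<open>3\<close>.  Finally, at every
  point of the \<open>z\<^sub>0\<close>-axis the coordinate directions of \<open>x, y, z\<^sub>0, z\<^sub>1\<close> are tangent to the variety,
  so this line through the origin is contained in the singular locus, and the origin cannot be
  isolated in it.\<close>


section \<open>Evaluation homomorphisms\<close>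

text \<open>Homomorphisms of whole types: polynomial rings in different numbers of variables all lie in
  the type of polynomials, so that substitutions need no carrier conditions.\<close>

locale ring_morphism =
  fixes h :: "'a::comm_ring_1 \<Rightarrow> 'b::comm_ring_1"
  assumes map_one: "h 1 = 1"
    and map_add: "h (x + y) = h x + h y"
    and map_mult: "h (x * y) = h x * h y"
begin

lemma map_zero: "h 0 = 0"
  using map_add[of 0 0] by simp

lemma map_uminus: "h (- x) = - h x"
  using map_add[of x "- x"] by (simp add: map_zero add_eq_0_iff)

lemma map_diff: "h (x - y) = h x - h y"
  using map_add[of x "- y"] by (simp add: map_uminus)

lemma map_power: "h (x ^ k) = h x ^ k"
  by (induction k) (simp_all add: map_one map_mult)

lemma map_sum: "h (sum f A) = (\<Sum>a\<in>A. h (f a))"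
  by (induction A rule: infinite_finite_induct) (simp_all add: map_zero map_add)

lemma map_prod: "h (prod f A) = (\<Prod>a\<in>A. h (f a))"
  by (induction A rule: infinite_finite_induct) (simp_all add: map_one map_mult)

lemmas map_simps = map_one map_zero map_add map_mult map_uminus map_diff map_power map_sum map_prod

end

lemma ring_morphism_comp:
  assumes "ring_morphism h" "ring_morphism k"
  shows "ring_morphism (h \<circ> k)"
proof -
  interpret h: ring_morphism h by fact
  interpret k: ring_morphism k by fact
  show ?thesis by unfold_locales (simp_all add: h.map_simps k.map_simps)
qed

lemma ring_morphism_id: "ring_morphism id"
  by unfold_locales simp_all

lemma poly_mapping_sum_monomials:
  "(\<Sum>m\<in>Poly_Mapping.keys f. Poly_Mapping.single m (Poly_Mapping.lookup f m)) = f"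
proof (rule poly_mapping_eqI)
  fix k
  show "Poly_Mapping.lookup (\<Sum>m\<in>Poly_Mapping.keys f. Poly_Mapping.single m (Poly_Mapping.lookup f m)) k
    = Poly_Mapping.lookup f k"
    by (cases "k \<in> Poly_Mapping.keys f")
      (simp_all add: lookup_sum lookup_single when_def sum.delta in_keys_iff)
qed

locale complex_algebra = ring_morphism \<iota> for \<iota> :: "complex \<Rightarrow> 'b::comm_ring_1"

locale monoid_algebra_morphism = complex_algebra \<iota>
  for \<iota> :: "complex \<Rightarrow> 'b::comm_ring_1" +
  fixes \<chi> :: "'m::comm_monoid_add \<Rightarrow> 'b"
  assumes char_zero: "\<chi> 0 = 1"
    and char_add: "\<chi> (p + q) = \<chi> p * \<chi> q"

text \<open>If \<open>\<chi>\<close> is multiplicative, this is the homomorphism of monoid algebras determined by \<open>\<chi>\<close>.  It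
  serves both for polynomials, where \<open>\<chi>\<close> evaluates monomials, and for Laurent polynomials.\<close>

definition linear_extension ::
  "(complex \<Rightarrow> 'b::comm_ring_1) \<Rightarrow> ('m \<Rightarrow> 'b) \<Rightarrow> ('m \<Rightarrow>\<^sub>0 complex) \<Rightarrow> 'b"
  where "linear_extension \<iota> \<chi> f =
    (\<Sum>m\<in>Poly_Mapping.keys f. \<iota> (Poly_Mapping.lookup f m) * \<chi> m)"

context complex_algebra
begin

lemma linear_extension_superset:
  assumes "finite A" "Poly_Mapping.keys f \<subseteq> A"
  shows "linear_extension \<iota> \<chi> f = (\<Sum>m\<in>A. \<iota> (Poly_Mapping.lookup f m) * \<chi> m)"
  unfolding linear_extension_def
  using assms by (intro sum.mono_neutral_left) (auto simp: map_zero in_keys_iff)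

lemma linear_extension_add:
  "linear_extension \<iota> \<chi> (f + g) = linear_extension \<iota> \<chi> f + linear_extension \<iota> \<chi> g"
proof -
  let ?A = "Poly_Mapping.keys f \<union> Poly_Mapping.keys g"
  show ?thesis
    using linear_extension_superset[of ?A f \<chi>] linear_extension_superset[of ?A g \<chi>]
      linear_extension_superset[of ?A "f + g" \<chi>] Poly_Mapping.keys_add[of f g]
    by (simp add: lookup_add map_add distrib_right sum.distrib)
qed

lemma linear_extension_zero: "linear_extension \<iota> \<chi> 0 = 0"
  by (simp add: linear_extension_def)

lemma linear_extension_sum:
  "linear_extension \<iota> \<chi> (sum f A) = (\<Sum>a\<in>A. linear_extension \<iota> \<chi> (f a))"
  by (induction A rule: infinite_finite_induct)
    (simp_all add: linear_extension_add linear_extension_zero)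

lemma linear_extension_single:
  "linear_extension \<iota> \<chi> (Poly_Mapping.single m c) = \<iota> c * \<chi> m"
  by (cases "c = 0") (simp_all add: linear_extension_def map_zero)

end

lemma (in monoid_algebra_morphism) ring_morphism_linear_extension:
  "ring_morphism (linear_extension \<iota> \<chi>)"
proof
  show "linear_extension \<iota> \<chi> 1 = 1"
    using linear_extension_single[of \<chi> 0 1] by (simp add: map_one char_zero)
  show "linear_extension \<iota> \<chi> (f + g) = linear_extension \<iota> \<chi> f + linear_extension \<iota> \<chi> g" for f g
    by (rule linear_extension_add)
  show "linear_extension \<iota> \<chi> (f * g) = linear_extension \<iota> \<chi> f * linear_extension \<iota> \<chi> g" for f g
  proof -
    let ?s = "\<lambda>f m. Poly_Mapping.single m (Poly_Mapping.lookup f m)"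
    have fg: "f * g = (\<Sum>p\<in>Poly_Mapping.keys f. ?s f p) * (\<Sum>q\<in>Poly_Mapping.keys g. ?s g q)"
      by (simp add: poly_mapping_sum_monomials)
    have "linear_extension \<iota> \<chi> (f * g) =
      (\<Sum>p\<in>Poly_Mapping.keys f. \<Sum>q\<in>Poly_Mapping.keys g. linear_extension \<iota> \<chi> (?s f p * ?s g q))"
      unfolding fg by (simp add: sum_product linear_extension_sum)
    also have "\<dots> = linear_extension \<iota> \<chi> f * linear_extension \<iota> \<chi> g"
      unfolding linear_extension_def[of _ _ f] linear_extension_def[of _ _ g] sum_product
      by (intro sum.cong refl) (simp add: mult_single linear_extension_single map_mult char_add mult_ac)
    finally show ?thesis .
  qed
qed

definition subst :: "(complex \<Rightarrow> 'b::comm_ring_1) \<Rightarrow> (nat \<Rightarrow> 'b) \<Rightarrow> cpoly \<Rightarrow> 'b"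
  where "subst \<iota> g = linear_extension \<iota>
    (\<lambda>m. \<Prod>i\<in>Poly_Mapping.keys m. g i ^ Poly_Mapping.lookup m i)"

lemma eval_at_eq_subst: "eval_at p = subst id p"
  by (rule ext) (simp add: eval_at_def subst_def linear_extension_def)

lemma monomial_value_superset:
  fixes g :: "nat \<Rightarrow> 'b::comm_ring_1"
  assumes "finite A" "Poly_Mapping.keys m \<subseteq> A"
  shows "(\<Prod>i\<in>Poly_Mapping.keys m. g i ^ Poly_Mapping.lookup m i)
    = (\<Prod>i\<in>A. g i ^ Poly_Mapping.lookup m i)"
  using assms by (intro prod.mono_neutral_left) (auto simp: in_keys_iff)

lemma monoid_algebra_morphism_monomial_value:
  fixes g :: "nat \<Rightarrow> 'b::comm_ring_1"
  assumes "ring_morphism \<iota>"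
  shows "monoid_algebra_morphism \<iota> (\<lambda>m. \<Prod>i\<in>Poly_Mapping.keys m. g i ^ Poly_Mapping.lookup m i)"
proof -
  interpret ring_morphism \<iota> by fact
  show ?thesis
  proof
    fix p q :: "nat \<Rightarrow>\<^sub>0 nat"
    let ?A = "Poly_Mapping.keys p \<union> Poly_Mapping.keys q"
    show "(\<Prod>i\<in>Poly_Mapping.keys (p + q). g i ^ Poly_Mapping.lookup (p + q) i) =
      (\<Prod>i\<in>Poly_Mapping.keys p. g i ^ Poly_Mapping.lookup p i) *
      (\<Prod>i\<in>Poly_Mapping.keys q. g i ^ Poly_Mapping.lookup q i)"
      using monomial_value_superset[of ?A p g] monomial_value_superset[of ?A q g]
        monomial_value_superset[of ?A "p + q" g] Poly_Mapping.keys_add[of p q]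
      by (simp add: lookup_add power_add prod.distrib)
  qed simp
qed

lemma ring_morphism_subst: "ring_morphism \<iota> \<Longrightarrow> ring_morphism (subst \<iota> g)"
  unfolding subst_def
  by (rule monoid_algebra_morphism.ring_morphism_linear_extension[OF monoid_algebra_morphism_monomial_value])

lemma subst_scalar: "ring_morphism \<iota> \<Longrightarrow> subst \<iota> g (scalar c) = \<iota> c"
  unfolding subst_def scalar_def by (simp add: complex_algebra.linear_extension_single complex_algebra_def)

lemma subst_pvar: "ring_morphism \<iota> \<Longrightarrow> subst \<iota> g (pvar i) = g i"
  unfolding subst_def pvar_def
  by (simp add: complex_algebra.linear_extension_single complex_algebra_def ring_morphism.map_one)

lemma ring_morphism_scalar: "ring_morphism (scalar :: complex \<Rightarrow> 'm::comm_monoid_add \<Rightarrow>\<^sub>0 complex)"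
  by unfold_locales (simp_all add: scalar_def single_add mult_single)

lemma subst_comp:
  assumes "ring_morphism h"
  shows "h (subst \<iota> g f) = subst (h \<circ> \<iota>) (h \<circ> g) f"
proof -
  interpret h: ring_morphism h by fact
  show ?thesis by (simp add: subst_def linear_extension_def h.map_simps)
qed

lemma single_eq_scalar_monomial:
  "Poly_Mapping.single m c = scalar c * (\<Prod>i\<in>Poly_Mapping.keys m. pvar i ^ Poly_Mapping.lookup m i)"
proof -
  have pow: "pvar i ^ k = Poly_Mapping.single (Poly_Mapping.single i k) 1" for i k
    by (induction k) (simp_all add: pvar_def mult_single flip: single_add)
  have "(\<Prod>i\<in>A. pvar i ^ Poly_Mapping.lookup m i) =
    Poly_Mapping.single (\<Sum>i\<in>A. Poly_Mapping.single i (Poly_Mapping.lookup m i)) (1::complex)" if "finite A" for A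
    using that by (induction A rule: finite_induct) (simp_all add: pow mult_single)
  then show ?thesis
    by (simp add: poly_mapping_sum_monomials scalar_def mult_single)
qed

lemma subst_generic_point: "subst scalar pvar f = f"
proof -
  have "subst scalar pvar f = (\<Sum>m\<in>Poly_Mapping.keys f. Poly_Mapping.single m (Poly_Mapping.lookup f m))"
    unfolding subst_def linear_extension_def by (simp add: single_eq_scalar_monomial)
  then show ?thesis by (simp add: poly_mapping_sum_monomials)
qed

text \<open>Points that are congruent modulo \<open>d\<close> have congruent values.  For \<open>d = x + y\<close> this is the factor
  theorem: a polynomial that vanishes after \<open>y\<close> is replaced by \<open>- x\<close> is divisible by \<open>x + y\<close>.\<close>

lemma dvd_subst_diff:
  fixes g g' :: "nat \<Rightarrow> 'b::comm_ring_1"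
  assumes "\<And>i. d dvd g i - g' i"
  shows "d dvd subst \<iota> g f - subst \<iota> g' f"
proof -
  have pow: "d dvd x ^ k - y ^ k" if "d dvd x - y" for x y :: 'b and k
    using that by (simp add: power_diff_sumr2)
  have mono: "d dvd (\<Prod>i\<in>A. g i ^ e i) - (\<Prod>i\<in>A. g' i ^ e i)" if "finite A" for A e
    using that
  proof (induction A rule: finite_induct)
    case (insert a A)
    have "(\<Prod>i\<in>insert a A. g i ^ e i) - (\<Prod>i\<in>insert a A. g' i ^ e i)
      = g a ^ e a * ((\<Prod>i\<in>A. g i ^ e i) - (\<Prod>i\<in>A. g' i ^ e i))
        + (g a ^ e a - g' a ^ e a) * (\<Prod>i\<in>A. g' i ^ e i)"
      using insert.hyps by (simp add: algebra_simps)
    then show ?case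
      using insert.IH pow[OF assms[of a], of "e a"] by (simp add: dvd_add dvd_mult dvd_mult2)
  qed simp
  show ?thesis
    unfolding subst_def linear_extension_def sum_subtractf[symmetric] right_diff_distrib[symmetric]
    by (intro dvd_sum dvd_mult mono) simp
qed


section \<open>The polynomial ring\<close>

abbreviation Pol :: "nat \<Rightarrow> cpoly set"
  where "Pol N \<equiv> carrier (polynomial_ring N)"

lemma Pol_iff: "f \<in> Pol N \<longleftrightarrow> (\<forall>m\<in>Poly_Mapping.keys f. Poly_Mapping.keys m \<subseteq> {1..N})"
  by (simp add: polynomial_ring_def)

lemma polynomial_ring_simps [simp]:
  "monoid.mult (polynomial_ring N) = (*)" "one (polynomial_ring N) = 1"
  "ring.zero (polynomial_ring N) = 0" "ring.add (polynomial_ring N) = (+)"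
  by (simp_all add: polynomial_ring_def ring_of_type_algebra_def fun_eq_iff)

lemma Pol_scalar: "scalar c \<in> Pol N"
  by (simp add: Pol_iff scalar_def)

lemma Pol_zero: "0 \<in> Pol N"
  by (simp add: Pol_iff)

lemma Pol_one: "1 \<in> Pol N"
  by (simp add: Pol_iff)

lemma Pol_pvar: "i \<in> {1..N} \<Longrightarrow> pvar i \<in> Pol N"
  by (simp add: Pol_iff pvar_def)

lemma Pol_add: "f \<in> Pol N \<Longrightarrow> g \<in> Pol N \<Longrightarrow> f + g \<in> Pol N"
  using Poly_Mapping.keys_add[of f g] by (auto simp: Pol_iff)

lemma Pol_uminus: "f \<in> Pol N \<Longrightarrow> - f \<in> Pol N"
  by (simp add: Pol_iff)

lemma Pol_diff: "f \<in> Pol N \<Longrightarrow> g \<in> Pol N \<Longrightarrow> f - g \<in> Pol N"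
  using Pol_add[of f N "- g"] by (simp add: Pol_uminus)

lemma Pol_mult: "f \<in> Pol N \<Longrightarrow> g \<in> Pol N \<Longrightarrow> f * g \<in> Pol N"
proof -
  assume f: "f \<in> Pol N" and g: "g \<in> Pol N"
  show "f * g \<in> Pol N"
    unfolding Pol_iff
  proof
    fix m assume "m \<in> Poly_Mapping.keys (f * g)"
    then obtain p q where "m = p + q" "p \<in> Poly_Mapping.keys f" "q \<in> Poly_Mapping.keys g"
      using Poly_Mapping.keys_mult[of f g] by auto
    then show "Poly_Mapping.keys m \<subseteq> {1..N}"
      using f g Poly_Mapping.keys_add[of p q] by (force simp: Pol_iff)
  qed
qed

lemma Pol_power: "f \<in> Pol N \<Longrightarrow> f ^ k \<in> Pol N"
  by (induction k) (simp_all add: Pol_one Pol_mult)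

lemma Pol_sum: "(\<And>a. a \<in> A \<Longrightarrow> f a \<in> Pol N) \<Longrightarrow> sum f A \<in> Pol N"
  by (induction A rule: infinite_finite_induct) (simp_all add: Pol_zero Pol_add)

lemma Pol_prod: "(\<And>a. a \<in> A \<Longrightarrow> f a \<in> Pol N) \<Longrightarrow> prod f A \<in> Pol N"
  by (induction A rule: infinite_finite_induct) (simp_all add: Pol_one Pol_mult)

lemmas Pol_closed = Pol_scalar Pol_zero Pol_one Pol_pvar Pol_add Pol_uminus Pol_diff Pol_mult
  Pol_power Pol_sum Pol_prod

lemma domain_polynomial_ring: "domain (polynomial_ring N)"
proof (rule domainI)
  show "cring (polynomial_ring N)"
  proof (rule cringI)
    show "abelian_group (polynomial_ring N)"
      by (rule abelian_groupI)
        (auto simp: Pol_closed add_ac intro: bexI[of _ "- x" for x])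
    show "comm_monoid (polynomial_ring N)"
      by (rule comm_monoidI) (auto simp: Pol_closed mult_ac)
  qed (simp add: distrib_right)
qed auto

lemma cring_polynomial_ring: "cring (polynomial_ring N)"
  using domain_polynomial_ring by (rule domain.axioms)

lemma ring_polynomial_ring: "ring (polynomial_ring N)"
  using cring_polynomial_ring by (rule cring.axioms)

lemma Pol_a_inv: "f \<in> Pol N \<Longrightarrow> \<ominus>\<^bsub>polynomial_ring N\<^esub> f = - f"
proof -
  assume f: "f \<in> Pol N"
  interpret ring "polynomial_ring N" by (rule ring_polynomial_ring)
  show ?thesis
    using minus_equality[of "- f" f] f by (simp add: Pol_uminus)
qed

lemma subst_cong_on:
  assumes "f \<in> Pol N" "\<And>i. i \<in> {1..N} \<Longrightarrow> g i = g' i"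
  shows "subst \<iota> g f = subst \<iota> g' f"
  unfolding subst_def linear_extension_def
proof (intro sum.cong arg_cong2[where f="(*)"] prod.cong refl)
  fix m i assume "m \<in> Poly_Mapping.keys f" "i \<in> Poly_Mapping.keys m"
  then have "i \<in> {1..N}" using assms(1) by (auto simp only: Pol_iff)
  then show "g i ^ Poly_Mapping.lookup m i = g' i ^ Poly_Mapping.lookup m i"
    by (simp add: assms(2))
qed


section \<open>The dimension of the polynomial ring\<close>

definition exponents_le :: "nat \<Rightarrow> nat \<Rightarrow> (nat \<Rightarrow>\<^sub>0 nat) set"
  where "exponents_le N D = {m. Poly_Mapping.keys m \<subseteq> {1..N} \<and> (\<forall>j. Poly_Mapping.lookup m j \<le> D)}"

lemma finite_card_exponents_le:
  "finite (exponents_le N D) \<and> card (exponents_le N D) \<le> (D + 1) ^ N"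
proof -
  let ?r = "\<lambda>m. restrict (Poly_Mapping.lookup m) {1..N}"
  let ?B = "PiE {1..N} (\<lambda>_. {..D})"
  have inj: "inj_on ?r (exponents_le N D)"
  proof
    fix m m' assume m: "m \<in> exponents_le N D" "m' \<in> exponents_le N D" and eq: "?r m = ?r m'"
    show "m = m'"
    proof (rule poly_mapping_eqI)
      fix j
      show "Poly_Mapping.lookup m j = Poly_Mapping.lookup m' j"
      proof (cases "j \<in> {1..N}")
        case True
        then show ?thesis using fun_cong[OF eq, of j] by simp
      next
        case False
        then have "j \<notin> Poly_Mapping.keys m" "j \<notin> Poly_Mapping.keys m'"
          using m unfolding exponents_le_def by blast+
        then show ?thesis by (simp add: in_keys_iff)
      qed
    qed
  qed
  have sub: "?r ` exponents_le N D \<subseteq> ?B"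
    by (auto simp: exponents_le_def)
  have fin: "finite ?B" by (rule finite_PiE) simp_all
  have card: "card ?B = (D + 1) ^ N" by (simp add: card_PiE)
  show ?thesis
    using inj sub fin card by (metis card_inj_on_le inj_on_finite)
qed

lemma exponents_le_mult:
  assumes "Poly_Mapping.keys f \<subseteq> exponents_le N D" "Poly_Mapping.keys g \<subseteq> exponents_le N D'"
  shows "Poly_Mapping.keys (f * g) \<subseteq> exponents_le N (D + D')"
proof
  fix m assume "m \<in> Poly_Mapping.keys (f * g)"
  then obtain p q where m: "m = p + q" "p \<in> Poly_Mapping.keys f" "q \<in> Poly_Mapping.keys g"
    using Poly_Mapping.keys_mult[of f g] by auto
  then have "p \<in> exponents_le N D" "q \<in> exponents_le N D'" using assms by blast+
  then show "m \<in> exponents_le N (D + D')"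
    using Poly_Mapping.keys_add[of p q] unfolding m(1) exponents_le_def
    by (auto simp: lookup_add intro: add_mono)
qed

lemma exponents_le_power:
  fixes f :: cpoly
  assumes "Poly_Mapping.keys f \<subseteq> exponents_le N D"
  shows "Poly_Mapping.keys (f ^ k) \<subseteq> exponents_le N (k * D)"
proof (induction k)
  case 0
  then show ?case by (simp add: exponents_le_def)
next
  case (Suc k)
  then show ?case using exponents_le_mult[OF assms, of "f ^ k" "k * D"] by simp
qed

lemma exponents_le_prod:
  fixes f :: "'i \<Rightarrow> cpoly"
  assumes "finite A" "\<And>a. a \<in> A \<Longrightarrow> Poly_Mapping.keys (f a) \<subseteq> exponents_le N D"
  shows "Poly_Mapping.keys (prod f A) \<subseteq> exponents_le N (card A * D)"
  using assms
proof (induction A rule: finite_induct)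
  case empty
  then show ?case by (simp add: exponents_le_def)
next
  case (insert a A)
  then show ?case using exponents_le_mult[of "f a" N D "prod f A" "card A * D"] by simp
qed

lemma exponents_le_mono: "D \<le> D' \<Longrightarrow> exponents_le N D \<subseteq> exponents_le N D'"
  by (auto simp: exponents_le_def intro: le_trans)

lemma exponents_bounded:
  assumes "f \<in> Pol N"
  obtains D where "Poly_Mapping.keys f \<subseteq> exponents_le N D"
proof -
  let ?B = "insert 0 ((\<lambda>(m, j). Poly_Mapping.lookup m j) ` (Poly_Mapping.keys f \<times> {1..N}))"
  have "Poly_Mapping.lookup m j \<le> Max ?B" if m: "m \<in> Poly_Mapping.keys f" for m j
  proof (cases "j \<in> Poly_Mapping.keys m")
    case True
    then have "j \<in> {1..N}" using assms m unfolding Pol_iff by blast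
    then show ?thesis using m by (intro Max_ge) force+
  next
    case False
    then show ?thesis by (simp add: in_keys_iff)
  qed
  then have "Poly_Mapping.keys f \<subseteq> exponents_le N (Max ?B)"
    using assms unfolding exponents_le_def Pol_iff by blast
  then show ?thesis by (rule that)
qed

lemma vector_space_scalar: "vector_space (\<lambda>c (f::cpoly). scalar c * f)"
proof -
  interpret ring_morphism "scalar :: complex \<Rightarrow> cpoly" by (rule ring_morphism_scalar)
  show ?thesis by unfold_locales (simp_all add: map_simps algebra_simps)
qed

text \<open>There are \<open>k ^ (N + 1)\<close> products of powers with exponents below \<open>k\<close> of \<open>N + 1\<close> polynomials, but they
  lie in the span of \<open>O(k ^ N)\<close> monomials; for large \<open>k\<close> they are linearly dependent.\<close>

lemma algebraically_dependent:
  fixes x :: "nat \<Rightarrow> cpoly"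
  assumes x: "\<And>i. i \<le> N \<Longrightarrow> x i \<in> Pol N"
  obtains E c where "finite E" "E \<noteq> {}" "\<forall>e\<in>E. c e \<noteq> (0::complex)"
    "inj_on (\<lambda>e. restrict e {0..N}) E"
    "(\<Sum>e\<in>E. scalar (c e) * (\<Prod>i=0..N. x i ^ e i)) = 0"
proof -
  interpret vector_space "\<lambda>c (f::cpoly). scalar c * f" by (rule vector_space_scalar)
  interpret s: ring_morphism "scalar :: complex \<Rightarrow> cpoly" by (rule ring_morphism_scalar)
  have "\<exists>D. \<forall>i\<le>N. Poly_Mapping.keys (x i) \<subseteq> exponents_le N D"
  proof -
    have "\<exists>D. Poly_Mapping.keys (x i) \<subseteq> exponents_le N D" if "i \<le> N" for i
      using exponents_bounded[OF x[OF that]] by blast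
    then obtain D where D: "\<And>i. i \<le> N \<Longrightarrow> Poly_Mapping.keys (x i) \<subseteq> exponents_le N (D i)"
      by metis
    have "Poly_Mapping.keys (x i) \<subseteq> exponents_le N (Max (D ` {..N}))" if "i \<le> N" for i
      using D[OF that] exponents_le_mono[of "D i" "Max (D ` {..N})" N] that by force
    then show ?thesis by blast
  qed
  then obtain D where D: "\<And>i. i \<le> N \<Longrightarrow> Poly_Mapping.keys (x i) \<subseteq> exponents_le N D" by blast
  \<comment> \<open>The exponents in a product of powers are less than \<open>q * k\<close>, and \<open>k\<close> exceeds \<open>q ^ N\<close>, so that
    \<open>(q * k) ^ N < k ^ (N + 1)\<close>.\<close>
  define q where "q = (N + 1) * D + 1"
  define k where "k = q ^ N + 1"
  define box where "box = PiE {0..N} (\<lambda>_. {..<k})"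
  define M where "M = (N + 1) * ((k - 1) * D)"
  define y where "y e = (\<Prod>i=0..N. x i ^ e i)" for e :: "nat \<Rightarrow> nat"
  have fin_box: "finite box" unfolding box_def by (rule finite_PiE) simp_all
  have card_box: "card box = k ^ (N + 1)" unfolding box_def by (simp add: card_PiE)
  have y_keys: "Poly_Mapping.keys (y e) \<subseteq> exponents_le N M" if "e \<in> box" for e
  proof -
    have "Poly_Mapping.keys (x i ^ e i) \<subseteq> exponents_le N ((k - 1) * D)" if "i \<in> {0..N}" for i
    proof -
      have "e i < k" using \<open>e \<in> box\<close> that by (auto simp: box_def)
      then have "e i * D \<le> (k - 1) * D" by (intro mult_le_mono1) simp
      then have "exponents_le N (e i * D) \<subseteq> exponents_le N ((k - 1) * D)" by (rule exponents_le_mono)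
      moreover have "Poly_Mapping.keys (x i ^ e i) \<subseteq> exponents_le N (e i * D)"
        using that by (intro exponents_le_power D) simp
      ultimately show ?thesis by (rule order_trans[rotated])
    qed
    then show ?thesis
      using exponents_le_prod[of "{0..N}" "\<lambda>i. x i ^ e i" N "(k - 1) * D"]
      by (simp add: y_def M_def)
  qed
  define T where "T = (\<lambda>m. Poly_Mapping.single m (1::complex)) ` exponents_le N M"
  have fin_T: "finite T" using finite_card_exponents_le unfolding T_def by blast
  have "card T \<le> (M + 1) ^ N"
    using finite_card_exponents_le[of N M] card_image_le[of "exponents_le N M"]
    unfolding T_def by (meson le_trans)
  also have "\<dots> \<le> (q * k) ^ N"
  proof (rule power_mono)
    have "(k - 1) * D \<le> k * D" by (intro mult_le_mono1) simp
    then have "M \<le> (N + 1) * (k * D)" unfolding M_def by (rule mult_le_mono2)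
    moreover have "1 \<le> k" by (simp add: k_def)
    ultimately have "M + 1 \<le> (N + 1) * (k * D) + k" by (rule add_mono)
    also have "\<dots> = q * k" unfolding q_def by (simp add: algebra_simps)
    finally show "M + 1 \<le> q * k" .
  qed simp
  also have "\<dots> < card box"
  proof -
    have "q ^ N * k ^ N < k * k ^ N"
      by (rule mult_strict_right_mono) (simp_all add: k_def)
    then show ?thesis by (simp add: card_box power_mult_distrib)
  qed
  finally have card_less: "card T < card box" .
  have in_span: "y e \<in> span T" if "e \<in> box" for e
  proof -
    have "(\<Sum>m\<in>Poly_Mapping.keys (y e). scalar (Poly_Mapping.lookup (y e) m) * Poly_Mapping.single m 1) \<in> span T"
      using y_keys[OF that] by (intro span_sum span_scale span_base) (auto simp: T_def)
    then show ?thesis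
      by (simp add: scalar_def mult_single poly_mapping_sum_monomials)
  qed
  have restr: "restrict e {0..N} = e" if "e \<in> box" for e
    using that by (simp add: box_def PiE_restrict)
  show ?thesis
  proof (cases "inj_on y box")
    \<comment> \<open>If two of the products coincide, their difference is already a relation.\<close>
    case False
    then obtain e e' where e: "e \<in> box" "e' \<in> box" "e \<noteq> e'" "y e = y e'"
      by (auto simp: inj_on_def)
    show ?thesis
    proof (rule that[of "{e, e'}" "\<lambda>f. if f = e then 1 else -1"])
      show "inj_on (\<lambda>e. restrict e {0..N}) {e, e'}"
        using e restr by (auto simp: inj_on_def)
      show "(\<Sum>f\<in>{e, e'}. scalar (if f = e then 1 else - 1) * (\<Prod>i = 0..N. x i ^ f i)) = 0"
        using e by (simp add: y_def[symmetric] s.map_simps)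
    qed auto
  next
    case True
    have "dependent (y ` box)"
    proof (rule ccontr)
      assume "\<not> dependent (y ` box)"
      then have "card (y ` box) \<le> card T"
        using independent_span_bound[OF fin_T] in_span by blast
      then show False using card_image[OF True] card_less by simp
    qed
    then obtain t u where t: "finite t" "t \<subseteq> y ` box" "(\<Sum>v\<in>t. scalar (u v) * v) = 0" "\<exists>v\<in>t. u v \<noteq> 0"
      unfolding dependent_explicit by blast
    define E where "E = {e \<in> box. y e \<in> t \<and> u (y e) \<noteq> 0}"
    have E: "inj_on y E" "finite E" using True fin_box by (auto simp: E_def inj_on_def)
    have yE: "y ` E = {v \<in> t. u v \<noteq> 0}" using t(2) by (auto simp: E_def)
    show ?thesis
    proof (rule that[of E "\<lambda>e. u (y e)"])
      show "E \<noteq> {}" using t(4) yE by auto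
      show "\<forall>e\<in>E. u (y e) \<noteq> 0" by (simp add: E_def)
      show "inj_on (\<lambda>e. restrict e {0..N}) E"
        using restr by (intro inj_onI) (simp add: E_def)
      have "(\<Sum>e\<in>E. scalar (u (y e)) * y e) = (\<Sum>v\<in>y ` E. scalar (u v) * v)"
        using E(1) by (simp add: sum.reindex)
      also have "\<dots> = (\<Sum>v\<in>t. scalar (u v) * v)"
        unfolding yE using t(1) by (intro sum.mono_neutral_left) (auto simp: s.map_zero)
      finally show "(\<Sum>e\<in>E. scalar (u (y e)) * (\<Prod>i = 0..N. x i ^ e i)) = 0"
        using t(3) by (simp add: y_def)
    qed (use E in simp)
  qed
qed

lemma primeideal_PolD:
  assumes "primeideal P (polynomial_ring N)"
  shows "P \<subseteq> Pol N" "0 \<in> P" "f \<in> P \<Longrightarrow> g \<in> P \<Longrightarrow> f + g \<in> P" "f \<in> P \<Longrightarrow> - f \<in> P"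
    "f \<in> Pol N \<Longrightarrow> g \<in> P \<Longrightarrow> f * g \<in> P"
    "f \<in> Pol N \<Longrightarrow> g \<in> Pol N \<Longrightarrow> f * g \<in> P \<Longrightarrow> f \<in> P \<or> g \<in> P" "1 \<notin> P"
proof -
  interpret primeideal P "polynomial_ring N" by fact
  show 1: "P \<subseteq> Pol N" by (rule a_subset)
  show "0 \<in> P" using additive_subgroup.zero_closed[OF is_additive_subgroup] by simp
  show "f + g \<in> P" if "f \<in> P" "g \<in> P" using additive_subgroup.a_closed[OF is_additive_subgroup that] by simp
  show "- f \<in> P" if "f \<in> P"
    using additive_subgroup.a_inv_closed[OF is_additive_subgroup that] that 1 by (auto simp: Pol_a_inv)
  show mult: "f * g \<in> P" if "f \<in> Pol N" "g \<in> P" for f g using I_l_closed[of g f] that by simp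
  show "f \<in> P \<or> g \<in> P" if "f \<in> Pol N" "g \<in> Pol N" "f * g \<in> P"
    using I_prime[of f g] that by simp
  show "1 \<notin> P"
  proof
    assume "1 \<in> P"
    then have "Pol N \<subseteq> P" using mult[of _ 1] by auto
    then show False using I_notcarr 1 by blast
  qed
qed

lemma primeideal_PolI:
  assumes "P \<subseteq> Pol N" "0 \<in> P" "\<And>f g. f \<in> P \<Longrightarrow> g \<in> P \<Longrightarrow> f + g \<in> P"
    "\<And>f g. f \<in> Pol N \<Longrightarrow> g \<in> P \<Longrightarrow> f * g \<in> P"
    "\<And>f g. f \<in> Pol N \<Longrightarrow> g \<in> Pol N \<Longrightarrow> f * g \<in> P \<Longrightarrow> f \<in> P \<or> g \<in> P" "1 \<notin> P"
  shows "primeideal P (polynomial_ring N)"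
proof (rule primeidealI2)
  interpret cring "polynomial_ring N" by (rule cring_polynomial_ring)
  have minus: "- f \<in> P" if "f \<in> P" for f
    using assms(4)[of "-1" f] that by (simp add: Pol_closed)
  show "additive_subgroup P (polynomial_ring N)"
  proof (rule additive_subgroup.intro, rule subgroup.intro)
    fix f assume "f \<in> P"
    then show "inv\<^bsub>add_monoid (polynomial_ring N)\<^esub> f \<in> P"
      using minus[of f] Pol_a_inv[of f N] assms(1) by (auto simp: a_inv_def)
  qed (use assms in auto)
  show "Pol N \<noteq> P" using assms(6) Pol_one by blast
  show "\<And>f g. f \<in> P \<Longrightarrow> g \<in> Pol N \<Longrightarrow> g \<otimes>\<^bsub>polynomial_ring N\<^esub> f \<in> P"
    using assms(4) by simp
  show "f \<otimes>\<^bsub>polynomial_ring N\<^esub> g \<in> P" if "f \<in> P" "g \<in> Pol N" for f g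
    using assms(4)[OF that(2,1)] by (simp add: mult.commute)
qed (use assms cring_polynomial_ring in auto)

text \<open>In a longer chain \<open>C\<close> choose \<open>x i\<close> in \<open>C (Suc i)\<close> but not in \<open>C i\<close>.  These \<open>N + 1\<close> polynomials are
  algebraically dependent.  A polynomial relation modulo \<open>C j\<close> between \<open>x j, x (Suc j), \<dots>\<close> may be
  divided by the largest possible power of \<open>x j\<close>, because \<open>C j\<close> is prime; modulo \<open>C (Suc j)\<close>, where
  \<open>x j\<close> vanishes, it becomes a nontrivial relation between \<open>x (Suc j), x (Suc (Suc j)), \<dots>\<close>.
  In the end a nonzero constant lies in the last prime.\<close>

lemma prime_chain_polynomial_ring_length:
  assumes "prime_chain (polynomial_ring N) C k"
  shows "k \<le> N"
proof (rule ccontr)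
  assume "\<not> k \<le> N"
  then have gt: "N < k" by simp
  have prime: "primeideal (C j) (polynomial_ring N)" if "j \<le> N + 1" for j
    using assms that gt by (auto simp: prime_chain_def)
  have strict: "C j \<subset> C (Suc j)" if "j \<le> N" for j
    using assms that gt by (auto simp: prime_chain_def)
  have "\<exists>f. f \<in> C (Suc i) \<and> f \<notin> C i" if "i \<le> N" for i
    using strict[OF that] by blast
  then obtain x where x: "\<And>i. i \<le> N \<Longrightarrow> x i \<in> C (Suc i) \<and> x i \<notin> C i" by metis
  have xP: "x i \<in> Pol N" if "i \<le> N" for i
    using x[OF that] primeideal_PolD(1)[OF prime, of "Suc i"] that by auto
  obtain E c where E: "finite E" "E \<noteq> {}" "\<forall>e\<in>E. c e \<noteq> (0::complex)"
      "inj_on (\<lambda>e. restrict e {0..N}) E"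
      "(\<Sum>e\<in>E. scalar (c e) * (\<Prod>i=0..N. x i ^ e i)) = 0"
    using algebraically_dependent[of N x] xP by blast
  have "\<exists>E. finite E \<and> E \<noteq> {} \<and> (\<forall>e\<in>E. c e \<noteq> 0) \<and> inj_on (\<lambda>e. restrict e {j..N}) E \<and>
      (\<Sum>e\<in>E. scalar (c e) * (\<Prod>i=j..N. x i ^ e i)) \<in> C j" if "j \<le> N + 1" for j
    using that
  proof (induction j)
    case 0
    have "(\<Sum>e\<in>E. scalar (c e) * (\<Prod>i=0..N. x i ^ e i)) \<in> C 0"
      unfolding E(5) by (rule primeideal_PolD(2)[OF prime]) simp
    with E(1-4) show ?case by (intro exI[of _ E] conjI)
  next
    case (Suc j)
    then have j: "j \<le> N" "Suc j \<le> N + 1" "j \<le> N + 1" by auto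
    note P = primeideal_PolD[OF prime[OF j(2)]] and Q = primeideal_PolD[OF prime[OF j(3)]]
    obtain E where E: "finite E" "E \<noteq> {}" "\<forall>e\<in>E. c e \<noteq> 0" "inj_on (\<lambda>e. restrict e {j..N}) E"
        "(\<Sum>e\<in>E. scalar (c e) * (\<Prod>i=j..N. x i ^ e i)) \<in> C j"
      using Suc.IH[OF j(3)] by blast
    \<comment> \<open>The terms with minimal exponent of \<open>x j\<close> are those that survive modulo the next prime.\<close>
    define d where "d = Min ((\<lambda>e. e j) ` E)"
    have d_le: "d \<le> e j" if "e \<in> E" for e
      using that E(1) by (simp add: d_def)
    have "d \<in> (\<lambda>e. e j) ` E" unfolding d_def using E(1,2) by (intro Min_in) auto
    define E' where "E' = {e \<in> E. e j = d}"
    have "E' \<noteq> {}" using \<open>d \<in> _\<close> by (auto simp: E'_def)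
    define r where "r e = scalar (c e) * (\<Prod>i=Suc j..N. x i ^ e i)" for e
    have rP: "r e \<in> Pol N" for e
      unfolding r_def using xP by (intro Pol_mult Pol_scalar Pol_prod Pol_power) auto
    have split: "{j..N} = insert j {Suc j..N}" using j by auto
    have term_eq: "scalar (c e) * (\<Prod>i=j..N. x i ^ e i) = x j ^ d * (x j ^ (e j - d) * r e)" if "e \<in> E" for e
      unfolding r_def split using d_le[OF that] by (simp add: mult_ac flip: power_add)
    define s where "s = (\<Sum>e\<in>E. x j ^ (e j - d) * r e)"
    have sP: "s \<in> Pol N" unfolding s_def using xP[OF j(1)] rP by (intro Pol_sum Pol_mult Pol_power) auto
    have "x j ^ d * s \<in> C j"
      using E(5) term_eq by (simp add: s_def sum_distrib_left cong: sum.cong)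
    moreover have "x j ^ i \<notin> C j" for i
    proof (induction i)
      case 0
      then show ?case using Q(7) by simp
    next
      case (Suc i)
      then show ?case using Q(6)[of "x j" "x j ^ i"] x[OF j(1)] xP[OF j(1)] by (auto simp: Pol_power)
    qed
    ultimately have "s \<in> C j"
      using Q(6)[of "x j ^ d" s] sP xP[OF j(1)] by (auto simp: Pol_power)
    then have s: "s \<in> C (Suc j)" using strict[OF j(1)] by blast
    have sum_closed: "sum f A \<in> C (Suc j)" if "\<And>a. a \<in> A \<Longrightarrow> f a \<in> C (Suc j)" for f and A :: "(nat \<Rightarrow> nat) set"
      using that by (induction A rule: infinite_finite_induct) (auto intro: P)
    have rest: "(\<Sum>e\<in>E - E'. x j ^ (e j - d) * r e) \<in> C (Suc j)"
    proof (rule sum_closed)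
      fix e assume "e \<in> E - E'"
      then have "e j - d \<noteq> 0" using d_le[of e] by (auto simp: E'_def)
      then obtain l where l: "e j - d = Suc l" by (cases "e j - d") simp_all
      have "(x j ^ l * r e) * x j \<in> C (Suc j)"
        using P(5)[of "x j ^ l * r e" "x j"] x[OF j(1)] xP[OF j(1)] rP
        by (simp add: Pol_mult Pol_power)
      then show "x j ^ (e j - d) * r e \<in> C (Suc j)"
        by (simp add: l mult_ac)
    qed
    have "s = (\<Sum>e\<in>E - E'. x j ^ (e j - d) * r e) + (\<Sum>e\<in>E'. r e)"
    proof -
      have "s = (\<Sum>e\<in>E - E'. x j ^ (e j - d) * r e) + (\<Sum>e\<in>E'. x j ^ (e j - d) * r e)"
        unfolding s_def by (rule sum.subset_diff[OF _ E(1)]) (simp add: E'_def)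
      moreover have "(\<Sum>e\<in>E'. x j ^ (e j - d) * r e) = (\<Sum>e\<in>E'. r e)"
        by (rule sum.cong) (simp_all add: E'_def)
      ultimately show ?thesis by simp
    qed
    then have "(\<Sum>e\<in>E'. r e) = s + - (\<Sum>e\<in>E - E'. x j ^ (e j - d) * r e)" by simp
    then have "(\<Sum>e\<in>E'. r e) \<in> C (Suc j)"
      using P(3)[OF s P(4)[OF rest]] by simp
    moreover have "inj_on (\<lambda>e. restrict e {Suc j..N}) E'"
    proof (rule inj_onI)
      fix e e' assume e: "e \<in> E'" "e' \<in> E'" and eq: "restrict e {Suc j..N} = restrict e' {Suc j..N}"
      have "restrict e {j..N} = restrict e' {j..N}"
      proof
        fix i
        show "restrict e {j..N} i = restrict e' {j..N} i"
          using fun_cong[OF eq, of i] e by (cases "i = j") (auto simp: E'_def restrict_def split: if_splits)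
      qed
      then show "e = e'" using E(4) e by (auto simp: inj_on_def E'_def)
    qed
    moreover have "finite E'" "\<forall>e\<in>E'. c e \<noteq> 0" using E(1,3) by (auto simp: E'_def)
    ultimately show ?case
      using \<open>E' \<noteq> {}\<close> unfolding r_def by (intro exI[of _ E'] conjI)
  qed
  from this[OF order_refl] obtain E where E: "E \<noteq> {}" "\<forall>e\<in>E. c e \<noteq> 0"
      "inj_on (\<lambda>e. restrict e {N + 1..N}) E"
      "(\<Sum>e\<in>E. scalar (c e) * (\<Prod>i=N + 1..N. x i ^ e i)) \<in> C (N + 1)"
    by blast
  obtain e where e: "e \<in> E" using E(1) by blast
  have "f = e" if "f \<in> E" for f
    by (rule inj_onD[OF E(3) _ that e]) (rule ext, simp add: restrict_def)
  then have "E = {e}" using e by blast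
  then have "scalar (c e) \<in> C (N + 1)" using E(4) by (simp only: sum.insert finite.emptyI empty_iff not_False_eq_True sum.empty) simp
  then have "scalar (inverse (c e)) * scalar (c e) \<in> C (N + 1)"
    using primeideal_PolD(5)[OF prime[of "N + 1"]] Pol_scalar by blast
  moreover have "scalar (inverse (c e)) * scalar (c e) = (1::cpoly)"
    using E(2) e by (simp add: scalar_def mult_single)
  ultimately show False using primeideal_PolD(7)[OF prime[of "N + 1"]] by simp
qed


section \<open>The determinantal ideal\<close>

text \<open>The two entries of the first column of the matrix; the other columns consist of consecutive
  \<open>zvar i\<close>, with \<open>i\<close> running from \<open>0\<close> to \<open>n\<close>.\<close>

abbreviation row_sum :: cpoly
  where "row_sum \<equiv> pvar 1 + pvar 2"

abbreviation row_prod :: cpoly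
  where "row_prod \<equiv> pvar 1 * pvar 2"

abbreviation zvar :: "nat \<Rightarrow> cpoly"
  where "zvar i \<equiv> pvar (i + 3)"

lemma minors_iff:
  "f \<in> minors n \<longleftrightarrow>
    (\<exists>i<n. f = row_sum * zvar (Suc i) - zvar i * row_prod) \<or>
    (\<exists>i j. i < j \<and> j < n \<and> f = zvar i * zvar (Suc j) - zvar j * zvar (Suc i))"
proof
  assume "f \<in> minors n"
  then obtain j k where jk: "1 \<le> j" "j < k" "k \<le> n + 1"
    and f: "f = mirror_matrix 1 j * mirror_matrix 2 k - mirror_matrix 1 k * mirror_matrix 2 j"
    by (auto simp: minors_def)
  define k' where "k' = k - 2"
  have k: "k = k' + 2" "k' < n" using jk by (auto simp: k'_def)
  show "(\<exists>i<n. f = row_sum * zvar (Suc i) - zvar i * row_prod) \<or>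
    (\<exists>i j. i < j \<and> j < n \<and> f = zvar i * zvar (Suc j) - zvar j * zvar (Suc i))"
  proof (cases "j = 1")
    case True
    then have "f = row_sum * zvar (Suc k') - zvar k' * row_prod"
      by (simp add: f k mirror_matrix_def eval_nat_numeral)
    then show ?thesis using k by blast
  next
    case False
    define j' where "j' = j - 2"
    have j: "j = j' + 2" "j' < k'" using jk False k by (auto simp: j'_def)
    have "f = zvar j' * zvar (Suc k') - zvar k' * zvar (Suc j')"
      by (simp add: f k j mirror_matrix_def eval_nat_numeral)
    then show ?thesis using k j by blast
  qed
next
  assume "(\<exists>i<n. f = row_sum * zvar (Suc i) - zvar i * row_prod) \<or>
    (\<exists>i j. i < j \<and> j < n \<and> f = zvar i * zvar (Suc j) - zvar j * zvar (Suc i))"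
  then show "f \<in> minors n"
  proof (elim disjE exE conjE)
    fix i assume "i < n" "f = row_sum * zvar (Suc i) - zvar i * row_prod"
    then show ?thesis
      unfolding minors_def
      by (intro CollectI exI[of _ 1] exI[of _ "i + 2"]) (simp add: mirror_matrix_def eval_nat_numeral)
  next
    fix i j assume "i < j" "j < n" "f = zvar i * zvar (Suc j) - zvar j * zvar (Suc i)"
    then show ?thesis
      unfolding minors_def
      by (intro CollectI exI[of _ "i + 2"] exI[of _ "j + 2"]) (simp add: mirror_matrix_def eval_nat_numeral)
  qed
qed

lemma Pol_mirror_vars:
  "pvar 1 \<in> Pol (n + 3)" "pvar 2 \<in> Pol (n + 3)" "i \<le> n \<Longrightarrow> zvar i \<in> Pol (n + 3)"
  by (rule Pol_pvar, simp)+

lemma minors_Pol: "minors n \<subseteq> Pol (n + 3)"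
  by (auto simp only: minors_iff intro!: Pol_diff Pol_mult Pol_add Pol_mirror_vars)

lemma ideal_minor_ideal: "ideal (minor_ideal n) (polynomial_ring (n + 3))"
  unfolding minor_ideal_def
  by (rule ring.genideal_ideal[OF ring_polynomial_ring minors_Pol])

lemma minor_ideal_Pol: "minor_ideal n \<subseteq> Pol (n + 3)"
proof -
  interpret ideal "minor_ideal n" "polynomial_ring (n + 3)" by (rule ideal_minor_ideal)
  show ?thesis by (rule a_subset)
qed

lemma minors_minor_ideal: "minors n \<subseteq> minor_ideal n"
  unfolding minor_ideal_def by (rule ring.genideal_self[OF ring_polynomial_ring minors_Pol])

lemma minor_ideal_zero: "0 \<in> minor_ideal n"
proof -
  interpret ideal "minor_ideal n" "polynomial_ring (n + 3)" by (rule ideal_minor_ideal)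
  show ?thesis using additive_subgroup.zero_closed[OF is_additive_subgroup] by simp
qed

lemma minor_ideal_add: "f \<in> minor_ideal n \<Longrightarrow> g \<in> minor_ideal n \<Longrightarrow> f + g \<in> minor_ideal n"
proof -
  interpret ideal "minor_ideal n" "polynomial_ring (n + 3)" by (rule ideal_minor_ideal)
  show "f \<in> minor_ideal n \<Longrightarrow> g \<in> minor_ideal n \<Longrightarrow> f + g \<in> minor_ideal n"
    using additive_subgroup.a_closed[OF is_additive_subgroup] by simp
qed

lemma minor_ideal_mult: "f \<in> Pol (n + 3) \<Longrightarrow> g \<in> minor_ideal n \<Longrightarrow> f * g \<in> minor_ideal n"
proof -
  interpret ideal "minor_ideal n" "polynomial_ring (n + 3)" by (rule ideal_minor_ideal)
  show "f \<in> Pol (n + 3) \<Longrightarrow> g \<in> minor_ideal n \<Longrightarrow> f * g \<in> minor_ideal n"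
    using I_l_closed[of g f] by simp
qed

lemma minor_ideal_uminus: "f \<in> minor_ideal n \<Longrightarrow> - f \<in> minor_ideal n"
  using minor_ideal_mult[of "-1" n f] by (simp add: Pol_closed)

lemma minor_ideal_sum: "(\<And>a. a \<in> A \<Longrightarrow> f a \<in> minor_ideal n) \<Longrightarrow> sum f A \<in> minor_ideal n"
  by (induction A rule: infinite_finite_induct) (simp_all add: minor_ideal_zero minor_ideal_add)

text \<open>Used with \<open>d = 0\<close> to show that a homomorphism kills the ideal, and with the square of the
  parameter of a line to show that this line is tangent to the variety.\<close>

lemma dvd_on_minor_ideal:
  assumes "ring_morphism h" "\<And>f. f \<in> minors n \<Longrightarrow> d dvd h f" "f \<in> minor_ideal n"
  shows "d dvd h f"
proof -
  interpret h: ring_morphism h by fact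
  let ?J = "{f \<in> Pol (n + 3). d dvd h f}"
  interpret P: ring "polynomial_ring (n + 3)" by (rule ring_polynomial_ring)
  have "ideal ?J (polynomial_ring (n + 3))"
  proof (rule idealI[OF ring_polynomial_ring])
    show "subgroup ?J (add_monoid (polynomial_ring (n + 3)))"
    proof (rule subgroup.intro)
      fix f assume f: "f \<in> ?J"
      then have "inv\<^bsub>add_monoid (polynomial_ring (n + 3))\<^esub> f = - f"
        using Pol_a_inv[of f "n + 3"] by (simp add: a_inv_def)
      then show "inv\<^bsub>add_monoid (polynomial_ring (n + 3))\<^esub> f \<in> ?J"
        using f by (simp add: h.map_simps Pol_uminus)
    qed (auto simp: h.map_simps Pol_closed)
  qed (auto simp: h.map_simps Pol_closed)
  then have "minor_ideal n \<subseteq> ?J"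
    unfolding minor_ideal_def
    by (rule P.genideal_minimal) (use assms(2) minors_Pol in blast)
  then show ?thesis using assms(3) by blast
qed

lemma vanishes_on_minor_ideal:
  assumes "ring_morphism h"
    and "\<And>i. i < n \<Longrightarrow> h row_sum * h (zvar (Suc i)) = h (zvar i) * h row_prod"
    and "\<And>i j. i < j \<Longrightarrow> j < n \<Longrightarrow> h (zvar i) * h (zvar (Suc j)) = h (zvar j) * h (zvar (Suc i))"
    and "f \<in> minor_ideal n"
  shows "h f = 0"
proof -
  interpret h: ring_morphism h by fact
  have "0 dvd h f"
  proof (rule dvd_on_minor_ideal[OF assms(1) _ assms(4)])
    fix f assume "f \<in> minors n"
    then show "0 dvd h f"
      using assms(2,3) unfolding minors_iff h.map_mult h.map_add by (auto simp: h.map_mult h.map_add h.map_diff)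
  qed
  then show ?thesis by simp
qed

definition minor_cong :: "nat \<Rightarrow> cpoly \<Rightarrow> cpoly \<Rightarrow> bool"
  where "minor_cong n f g \<longleftrightarrow> f - g \<in> minor_ideal n"

lemma minor_cong_refl: "minor_cong n f f"
  by (simp add: minor_cong_def minor_ideal_zero)

lemma minor_cong_sym: "minor_cong n f g \<Longrightarrow> minor_cong n g f"
  unfolding minor_cong_def using minor_ideal_uminus[of "f - g" n] by simp

lemma minor_cong_trans [trans]: "minor_cong n f g \<Longrightarrow> minor_cong n g h \<Longrightarrow> minor_cong n f h"
  unfolding minor_cong_def using minor_ideal_add[of "f - g" n "g - h"] by simp

lemma minor_cong_mult:
  "h \<in> Pol (n + 3) \<Longrightarrow> minor_cong n f g \<Longrightarrow> minor_cong n (h * f) (h * g)"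
  unfolding minor_cong_def using minor_ideal_mult[of h n "f - g"] by (simp add: right_diff_distrib)

lemma minor_cong_sum:
  "(\<And>a. a \<in> A \<Longrightarrow> minor_cong n (f a) (g a)) \<Longrightarrow> minor_cong n (sum f A) (sum g A)"
  unfolding minor_cong_def sum_subtractf[symmetric] by (rule minor_ideal_sum)

lemma minor_cong_minor_ideal: "minor_cong n f g \<Longrightarrow> g \<in> minor_ideal n \<Longrightarrow> f \<in> minor_ideal n"
  unfolding minor_cong_def using minor_ideal_add[of "f - g" n g] by simp

lemma minor_cong_first_column:
  "i < n \<Longrightarrow> minor_cong n (row_sum * zvar (Suc i)) (row_prod * zvar i)"
  unfolding minor_cong_def mult.commute[of row_prod]
  by (rule subsetD[OF minors_minor_ideal]) (auto simp: minors_iff)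

lemma minor_cong_exchange:
  assumes "i < n" "j < n"
  shows "minor_cong n (zvar (Suc i) * zvar j) (zvar i * zvar (Suc j))"
proof -
  have *: "minor_cong n (zvar i * zvar (Suc j)) (zvar (Suc i) * zvar j)" if "i < j" "j < n" for i j
    unfolding minor_cong_def mult.commute[of "zvar (Suc i)"]
    by (rule subsetD[OF minors_minor_ideal]) (use that in \<open>auto simp only: minors_iff\<close>)
  consider "i < j" | "i = j" | "j < i" by linarith
  then show ?thesis
  proof cases
    case 1
    then show ?thesis using *[of i j] assms by (simp add: minor_cong_sym)
  next
    case 2
    then show ?thesis by (simp add: minor_cong_refl mult.commute)
  next
    case 3
    then show ?thesis using *[of j i] assms by (simp add: mult.commute)
  qed
qed

text \<open>The minors without the first column are the relations of the rational normal curve of degree \<open>n\<close>: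
  exchanging neighbours repeatedly moves index weight from one factor to the other.\<close>

lemma minor_cong_same_weight:
  assumes "i + k = i' + k'" "i \<le> n" "k \<le> n" "i' \<le> n" "k' \<le> n"
  shows "minor_cong n (zvar i * zvar k) (zvar i' * zvar k')"
proof -
  have *: "minor_cong n (zvar (i + d) * zvar k) (zvar i * zvar (k + d))" if "i + d \<le> n" "k + d \<le> n" for i k d
    using that
  proof (induction d arbitrary: k)
    case 0
    then show ?case by (simp add: minor_cong_refl)
  next
    case (Suc d)
    have "minor_cong n (zvar (Suc (i + d)) * zvar k) (zvar (i + d) * zvar (Suc k))"
      using Suc.prems by (intro minor_cong_exchange) auto
    also have "minor_cong n (zvar (i + d) * zvar (Suc k)) (zvar i * zvar (Suc k + d))"
      using Suc.prems by (intro Suc.IH) auto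
    finally show ?case by simp
  qed
  show ?thesis
  proof (cases "i' \<le> i")
    case True
    then obtain d where "i = i' + d" by (auto simp: le_iff_add)
    then show ?thesis using *[of i' d k] assms by (simp add: add.commute)
  next
    case False
    then obtain d where "i' = i + d" by (metis le_iff_add nat_le_linear)
    then have "minor_cong n (zvar i' * zvar k') (zvar i * zvar k)"
      using *[of i d k'] assms by (simp add: add.commute)
    then show ?thesis by (rule minor_cong_sym)
  qed
qed

text \<open>The standard monomial of degree \<open>c\<close> and weight \<open>m\<close>, filled greedily with the largest possible
  indices.  It really has weight \<open>m\<close> only if \<open>m \<le> n * c\<close>.\<close>

fun zmono :: "nat \<Rightarrow> nat \<Rightarrow> nat \<Rightarrow> cpoly"
  where "zmono n 0 m = 1"
  | "zmono n (Suc c) m = zvar (min m n) * zmono n c (m - min m n)"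

lemma Pol_zmono: "zmono n c m \<in> Pol (n + 3)"
  by (induction c arbitrary: m) (simp_all add: Pol_one Pol_mult Pol_mirror_vars)

text \<open>The new factor and the leading factor are rebalanced so that the leading one becomes as large as
  the greedy rule demands; the smaller remainder is absorbed by induction.\<close>

lemma zvar_mult_zmono:
  assumes "i \<le> n" "m \<le> n * c"
  shows "minor_cong n (zvar i * zmono n c m) (zmono n (Suc c) (m + i))"
  using assms
proof (induction c arbitrary: i m)
  case 0
  then show ?case by (simp add: minor_cong_refl)
next
  case (Suc c)
  define k where "k = min m n"
  define s where "s = min (m + i) n"
  have s: "s = min (k + i) n" using Suc.prems by (auto simp: s_def k_def)
  have mk: "m - k \<le> n * c" using Suc.prems by (auto simp: k_def)
  have "minor_cong n (zmono n c (m - k) * (zvar i * zvar k)) (zmono n c (m - k) * (zvar s * zvar (k + i - s)))"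
    using Suc.prems by (intro minor_cong_mult minor_cong_same_weight Pol_zmono) (auto simp: k_def s)
  then have "minor_cong n (zvar i * zmono n (Suc c) m) (zvar s * (zvar (k + i - s) * zmono n c (m - k)))"
    by (simp add: k_def mult_ac)
  also have "minor_cong n \<dots> (zvar s * zmono n (Suc c) (m - k + (k + i - s)))"
    using Suc.prems by (intro minor_cong_mult Suc.IH mk Pol_mirror_vars) (auto simp: s k_def)
  also have "m - k + (k + i - s) = m + i - s"
    using Suc.prems by (auto simp: s k_def)
  finally show ?case by (simp add: s_def)
qed

lemma zvar_power_mult_zmono:
  assumes "i \<le> n" "m \<le> n * c"
  shows "minor_cong n (zvar i ^ k * zmono n c m) (zmono n (c + k) (m + i * k))"
proof (induction k)
  case 0
  then show ?case by (simp add: minor_cong_refl)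
next
  case (Suc k)
  have "minor_cong n (zvar i * (zvar i ^ k * zmono n c m)) (zvar i * zmono n (c + k) (m + i * k))"
    by (intro minor_cong_mult Suc.IH Pol_mirror_vars assms)
  also have "minor_cong n \<dots> (zmono n (Suc (c + k)) (m + i * k + i))"
  proof (rule zvar_mult_zmono[OF assms(1)])
    have "i * k \<le> n * k" using assms by simp
    then show "m + i * k \<le> n * (c + k)" using assms(2) by (simp add: distrib_left add_mono)
  qed
  finally show ?case by (simp add: mult_ac add_ac)
qed

lemma zvar_prod_zmono:
  assumes "k \<le> Suc n"
  shows "minor_cong n (\<Prod>i<k. zvar i ^ e i) (zmono n (\<Sum>i<k. e i) (\<Sum>i<k. i * e i))"
  using assms
proof (induction k)
  case 0
  then show ?case by (simp add: minor_cong_refl)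
next
  case (Suc k)
  have "minor_cong n (zvar k ^ e k * (\<Prod>i<k. zvar i ^ e i))
      (zvar k ^ e k * zmono n (\<Sum>i<k. e i) (\<Sum>i<k. i * e i))"
    using Suc.prems by (intro minor_cong_mult Suc.IH Pol_power Pol_mirror_vars) auto
  also have "minor_cong n \<dots> (zmono n ((\<Sum>i<k. e i) + e k) ((\<Sum>i<k. i * e i) + k * e k))"
  proof (rule zvar_power_mult_zmono)
    show "(\<Sum>i<k. i * e i) \<le> n * (\<Sum>i<k. e i)"
      unfolding sum_distrib_left using Suc.prems by (intro sum_mono mult_le_mono1) auto
  qed (use Suc.prems in simp)
  finally show ?case by (simp add: mult_ac)
qed

text \<open>Bringing a factor with index above \<open>0\<close> to the front lets the first column lower the weight by one.\<close>

lemma row_sum_mult_zmono: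
  assumes "Suc m \<le> n * c"
  shows "minor_cong n (row_sum * zmono n c (Suc m)) (row_prod * zmono n c m)"
proof -
  obtain c' where c: "c = Suc c'" using assms by (cases c) auto
  have n: "n > 0" using assms by (cases n) auto
  define i where "i = min m (n - 1)"
  have i: "i < n" "m - i \<le> n * c'" "i \<le> m" using assms n by (auto simp: i_def c)
  have P: "row_sum \<in> Pol (n + 3)" "row_prod \<in> Pol (n + 3)"
    by (intro Pol_add Pol_mult Pol_mirror_vars)+
  have e1: "minor_cong n (zvar (Suc i) * zmono n c' (m - i)) (zmono n c (Suc m))"
    using zvar_mult_zmono[of "Suc i" n "m - i" c'] i by (simp add: c del: zmono.simps)
  have e2: "minor_cong n (zvar i * zmono n c' (m - i)) (zmono n c m)"
    using zvar_mult_zmono[of i n "m - i" c'] i by (simp add: c del: zmono.simps)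
  have "minor_cong n (row_sum * zmono n c (Suc m)) (row_sum * (zvar (Suc i) * zmono n c' (m - i)))"
    by (rule minor_cong_mult[OF P(1) minor_cong_sym[OF e1]])
  also have "minor_cong n \<dots> (row_prod * (zvar i * zmono n c' (m - i)))"
    using minor_cong_mult[OF Pol_zmono minor_cong_first_column[OF i(1)], of c' "m - i"]
    by (simp add: mult_ac)
  also have "minor_cong n \<dots> (row_prod * zmono n c m)"
    by (rule minor_cong_mult[OF P(2) e2])
  finally show ?thesis .
qed

lemma subst_scalar_Pol: "(\<And>i. g i \<in> Pol N) \<Longrightarrow> subst scalar g f \<in> Pol N"
  unfolding subst_def linear_extension_def
  by (intro Pol_sum Pol_mult Pol_scalar Pol_prod Pol_power)

text \<open>The divisibility takes place among polynomials in all variables; setting the variables beyond the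
  \<open>N\<close>-th to zero moves the cofactor into the ring.\<close>

lemma Pol_dvd_cofactor:
  assumes "s dvd f" "s \<in> Pol N" "f \<in> Pol N"
  obtains g where "g \<in> Pol N" "f = s * g"
proof -
  define t where "t i = (if i \<in> {1..N} then pvar i else 0)" for i
  interpret t: ring_morphism "subst scalar t" by (rule ring_morphism_subst[OF ring_morphism_scalar])
  have id: "subst scalar t h = h" if "h \<in> Pol N" for h
    using subst_cong_on[OF that, of t pvar scalar] by (simp add: t_def subst_generic_point)
  obtain g where "f = s * g" using assms(1) by (rule dvdE)
  then have "subst scalar t f = subst scalar t s * subst scalar t g"
    by (simp add: t.map_mult)
  then have "f = s * subst scalar t g"
    by (simp only: id[OF assms(2)] id[OF assms(3)])
  moreover have "subst scalar t g \<in> Pol N"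
    by (rule subst_scalar_Pol) (simp add: t_def Pol_pvar Pol_zero)
  ultimately show ?thesis using that by blast
qed

declare One_nat_def [simp del]

lemma pvar_nonzero: "pvar i \<noteq> 0"
proof
  assume "pvar i = 0"
  then have "subst id (\<lambda>_. 1) (pvar i) = (0::complex)"
    by (simp add: subst_def linear_extension_def)
  then show False by (simp add: subst_pvar[OF ring_morphism_id])
qed

lemma row_sum_nonzero: "row_sum \<noteq> 0"
proof
  assume eq: "row_sum = 0"
  interpret s: ring_morphism "subst id (\<lambda>_. 1::complex)" by (rule ring_morphism_subst[OF ring_morphism_id])
  have "subst id (\<lambda>_. 1) row_sum = (2::complex)"
    by (simp add: s.map_add subst_pvar[OF ring_morphism_id])
  then show False by (simp add: eq s.map_zero)
qed

text \<open>The summands of weight below the maximal one contain \<open>x + y\<close>.  Hence the coefficient of the maximal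
  weight vanishes for \<open>y = - x\<close> and is divisible by \<open>x + y\<close>, and the first column of the matrix
  transfers its term to the next lower weight.  At weight \<open>0\<close> the single coefficient is zero.\<close>

lemma homogeneous_relation_in_minor_ideal:
  assumes "\<And>j. j \<le> K \<Longrightarrow> F j \<in> Pol (n + 3)" "K \<le> n * c"
    and "(\<Sum>j\<le>K. F j * row_prod ^ j * row_sum ^ (K - j)) = 0"
  shows "(\<Sum>j\<le>K. F j * zmono n c j) \<in> minor_ideal n"
  using assms
proof (induction K arbitrary: F)
  case 0
  then show ?case by (simp add: minor_ideal_zero)
next
  case (Suc K)
  define g where "g = pvar(2 := - pvar 1)"
  interpret s: ring_morphism "subst scalar g" by (rule ring_morphism_subst[OF ring_morphism_scalar])
  have g: "subst scalar g (pvar 1) = pvar 1" "subst scalar g (pvar 2) = - pvar 1"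
    by (simp_all add: subst_pvar[OF ring_morphism_scalar] g_def)
  have "(\<Sum>j\<le>Suc K. subst scalar g (F j) * (- (pvar 1 * pvar 1)) ^ j * 0 ^ (Suc K - j)) = 0"
    using arg_cong[OF Suc.prems(3), of "subst scalar g"] by (simp add: s.map_simps g del: sum.atMost_Suc)
  moreover have "(\<Sum>j\<le>K. subst scalar g (F j) * (- (pvar 1 * pvar 1)) ^ j * 0 ^ (Suc K - j)) = 0"
    by (intro sum.neutral ballI) (simp add: Suc_diff_le)
  ultimately have "subst scalar g (F (Suc K)) * (- (pvar 1 * pvar 1)) ^ Suc K = 0"
    unfolding sum.atMost_Suc by simp
  then have "subst scalar g (F (Suc K)) = 0 \<or> (- (pvar 1 * pvar 1)) ^ Suc K = (0::cpoly)"
    by (rule mult_eq_0_iff[THEN iffD1])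
  moreover have "(- (pvar 1 * pvar 1)) ^ Suc K \<noteq> (0::cpoly)"
    by (metis mult_eq_0_iff neg_equal_0_iff_equal power_not_zero pvar_nonzero)
  ultimately have zero: "subst scalar g (F (Suc K)) = 0" by blast
  have "row_sum dvd subst scalar pvar (F (Suc K)) - subst scalar g (F (Suc K))"
    by (rule dvd_subst_diff) (simp add: g_def add.commute)
  then have "row_sum dvd F (Suc K)" by (simp add: zero subst_generic_point)
  then obtain G where G: "G \<in> Pol (n + 3)" "F (Suc K) = row_sum * G"
    using Suc.prems(1)[of "Suc K"] by (auto elim!: Pol_dvd_cofactor intro: Pol_add Pol_mirror_vars)
  define F' where "F' = F(K := F K + G * row_prod)"
  have split: "(\<Sum>j\<le>K. F' j * h j) = (\<Sum>j\<le>K. F j * h j) + G * row_prod * h K" for h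
  proof -
    have "(\<Sum>j\<le>K. F' j * h j) = (\<Sum>j\<le>K. F j * h j + (if j = K then G * row_prod * h K else 0))"
      by (intro sum.cong) (auto simp: F'_def algebra_simps)
    then show ?thesis by (simp add: sum.distrib)
  qed
  have "row_sum * (\<Sum>j\<le>K. F' j * (row_prod ^ j * row_sum ^ (K - j))) =
      (\<Sum>j\<le>K. F j * row_prod ^ j * row_sum ^ (Suc K - j)) + F (Suc K) * row_prod ^ Suc K"
    unfolding split distrib_left sum_distrib_left
    by (intro arg_cong2[where f="(+)"] sum.cong) (simp_all add: G(2) Suc_diff_le mult_ac)
  also have "\<dots> = 0" using Suc.prems(3) by simp
  finally have "(\<Sum>j\<le>K. F' j * row_prod ^ j * row_sum ^ (K - j)) = 0"
    using row_sum_nonzero by (simp add: mult.assoc)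
  moreover have "F' j \<in> Pol (n + 3)" if "j \<le> K" for j
    using Suc.prems(1) that G(1) by (auto simp: F'_def intro!: Pol_add Pol_mult Pol_mirror_vars)
  ultimately have IH: "(\<Sum>j\<le>K. F' j * zmono n c j) \<in> minor_ideal n"
    using Suc.prems(2) by (intro Suc.IH) auto
  have "row_sum * zmono n c (Suc K) - row_prod * zmono n c K \<in> minor_ideal n"
    using row_sum_mult_zmono[OF Suc.prems(2)] by (simp add: minor_cong_def)
  then have "(\<Sum>j\<le>K. F' j * zmono n c j) + G * (row_sum * zmono n c (Suc K) - row_prod * zmono n c K) \<in> minor_ideal n"
    by (intro minor_ideal_add IH minor_ideal_mult G)
  also have "(\<Sum>j\<le>K. F' j * zmono n c j) + G * (row_sum * zmono n c (Suc K) - row_prod * zmono n c K)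
    = (\<Sum>j\<le>Suc K. F j * zmono n c j)"
    by (simp add: split G(2) algebra_simps)
  finally show ?case .
qed


section \<open>The kernel of the parametrisation\<close>

lemma ring_morphism_const_scalar: "ring_morphism (\<lambda>c. [:scalar c :: cpoly:])"
proof -
  interpret s: ring_morphism "scalar :: complex \<Rightarrow> cpoly" by (rule ring_morphism_scalar)
  show ?thesis by unfold_locales (simp_all add: s.map_simps one_pCons)
qed

text \<open>The parametrisation \<open>z\<^sub>i = (xy)\<^sup>i (x + y)\<^sup>n\<^sup>-\<^sup>i t\<close>, with \<open>t\<close> the indeterminate of the outer polynomial ring.
  Taking coefficients in \<open>t\<close> separates the degrees in the \<open>z\<^sub>i\<close>.\<close>

definition scroll_param :: "nat \<Rightarrow> cpoly \<Rightarrow> cpoly poly"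
  where "scroll_param n = subst (\<lambda>c. [:scalar c:])
    (\<lambda>i. if i < 3 then [:pvar i:] else monom (row_prod ^ (i - 3) * row_sum ^ (n - (i - 3))) 1)"

lemma ring_morphism_scroll_param: "ring_morphism (scroll_param n)"
  unfolding scroll_param_def by (rule ring_morphism_subst[OF ring_morphism_const_scalar])

lemma scroll_param_simps:
  "scroll_param n (scalar c) = [:scalar c:]"
  "scroll_param n (pvar 1) = [:pvar 1:]"
  "scroll_param n (pvar 2) = [:pvar 2:]"
  "scroll_param n (zvar i) = monom (row_prod ^ i * row_sum ^ (n - i)) 1"
  unfolding scroll_param_def
  by (simp_all add: subst_scalar[OF ring_morphism_const_scalar] subst_pvar[OF ring_morphism_const_scalar])

lemma const_poly_power: "[:a:] ^ k = [:a ^ k:]" for a :: "'a::comm_semiring_1"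
  by (induction k) (simp_all add: one_pCons mult.commute)

lemma monom_prod: "finite A \<Longrightarrow> (\<Prod>i\<in>A. monom (a i) (e i)) = monom (\<Prod>i\<in>A. a i) (\<Sum>i\<in>A. e i)"
  for a :: "'i \<Rightarrow> 'a::comm_semiring_1"
  by (induction A rule: finite_induct) (simp_all add: mult_monom)

lemma Pol_monomial_split:
  assumes "Poly_Mapping.keys m \<subseteq> {1..n + 3}"
  shows "(\<Prod>i\<in>Poly_Mapping.keys m. pvar i ^ Poly_Mapping.lookup m i) =
    pvar 1 ^ Poly_Mapping.lookup m 1 * pvar 2 ^ Poly_Mapping.lookup m 2 *
    (\<Prod>i<Suc n. zvar i ^ Poly_Mapping.lookup m (i + 3))"
proof -
  have set_eq: "{1..n + 3} = insert 1 (insert 2 ((\<lambda>i. i + 3) ` {..<Suc n}))"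
  proof (rule Set.set_eqI)
    fix i
    show "i \<in> {1..n + 3} \<longleftrightarrow> i \<in> insert 1 (insert 2 ((\<lambda>i. i + 3) ` {..<Suc n}))"
    proof (cases "i < 3")
      case True
      then have "i = 0 \<or> i = 1 \<or> i = 2" by auto
      then show ?thesis by auto
    next
      case False
      then obtain j where "i = j + 3" by (metis le_iff_add not_less add.commute)
      then show ?thesis by auto
    qed
  qed
  have inj: "inj_on (\<lambda>i. i + 3) {..<Suc n}" by simp
  have "(\<Prod>i\<in>Poly_Mapping.keys m. pvar i ^ Poly_Mapping.lookup m i) =
      (\<Prod>i\<in>{1..n + 3}. pvar i ^ Poly_Mapping.lookup m i)"
    by (rule monomial_value_superset[OF _ assms]) simp
  also have "\<dots> = pvar 1 ^ Poly_Mapping.lookup m 1 * (pvar 2 ^ Poly_Mapping.lookup m 2 *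
      (\<Prod>i\<in>(\<lambda>i. i + 3) ` {..<Suc n}. pvar i ^ Poly_Mapping.lookup m i))"
    unfolding set_eq by (subst prod.insert, simp, force, subst prod.insert, simp, force, rule refl)
  also have "(\<Prod>i\<in>(\<lambda>i. i + 3) ` {..<Suc n}. pvar i ^ Poly_Mapping.lookup m i) =
      (\<Prod>i<Suc n. zvar i ^ Poly_Mapping.lookup m (i + 3))"
    by (simp only: prod.reindex[OF inj] comp_def)
  finally show ?thesis by (simp only: mult.assoc)
qed

definition zdeg :: "nat \<Rightarrow> (nat \<Rightarrow>\<^sub>0 nat) \<Rightarrow> nat"
  where "zdeg n m = (\<Sum>i<Suc n. Poly_Mapping.lookup m (i + 3))"

definition zweight :: "nat \<Rightarrow> (nat \<Rightarrow>\<^sub>0 nat) \<Rightarrow> nat"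
  where "zweight n m = (\<Sum>i<Suc n. i * Poly_Mapping.lookup m (i + 3))"

lemma zcoweight: "(\<Sum>i<Suc n. (n - i) * Poly_Mapping.lookup m (i + 3)) + zweight n m = n * zdeg n m"
proof -
  have "(\<Sum>i<Suc n. (n - i) * Poly_Mapping.lookup m (i + 3)) + zweight n m
    = (\<Sum>i<Suc n. n * Poly_Mapping.lookup m (i + 3))"
    unfolding zweight_def sum.distrib[symmetric]
    by (intro sum.cong refl) (auto simp flip: distrib_right)
  then show ?thesis by (simp only: zdeg_def sum_distrib_left)
qed

text \<open>The term of \<open>f\<close> at the exponent vector \<open>m\<close>, coefficient included, stripped of the \<open>z\<^sub>i\<close>.\<close>

definition xy_part :: "cpoly \<Rightarrow> (nat \<Rightarrow>\<^sub>0 nat) \<Rightarrow> cpoly"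
  where "xy_part f m =
    scalar (Poly_Mapping.lookup f m) * (pvar 1 ^ Poly_Mapping.lookup m 1 * pvar 2 ^ Poly_Mapping.lookup m 2)"

lemma Pol_xy_part: "xy_part f m \<in> Pol (n + 3)"
  unfolding xy_part_def by (intro Pol_mult Pol_scalar Pol_power Pol_mirror_vars)

lemma Pol_expansion:
  assumes "f \<in> Pol (n + 3)"
  shows "f = (\<Sum>m\<in>Poly_Mapping.keys f. xy_part f m * (\<Prod>i<Suc n. zvar i ^ Poly_Mapping.lookup m (i + 3)))"
proof -
  have "f = (\<Sum>m\<in>Poly_Mapping.keys f. Poly_Mapping.single m (Poly_Mapping.lookup f m))"
    by (simp add: poly_mapping_sum_monomials)
  also have "\<dots> = (\<Sum>m\<in>Poly_Mapping.keys f. xy_part f m * (\<Prod>i<Suc n. zvar i ^ Poly_Mapping.lookup m (i + 3)))"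
  proof (rule sum.cong[OF refl])
    fix m assume "m \<in> Poly_Mapping.keys f"
    then have "Poly_Mapping.keys m \<subseteq> {1..n + 3}" using assms unfolding Pol_iff by blast
    then show "Poly_Mapping.single m (Poly_Mapping.lookup f m) =
        xy_part f m * (\<Prod>i<Suc n. zvar i ^ Poly_Mapping.lookup m (i + 3))"
      by (simp only: single_eq_scalar_monomial[of m] Pol_monomial_split xy_part_def mult.assoc)
  qed
  finally show ?thesis .
qed

lemma scroll_param_expansion:
  assumes "f \<in> Pol (n + 3)"
  shows "scroll_param n f = (\<Sum>m\<in>Poly_Mapping.keys f.
    monom (xy_part f m * (row_prod ^ zweight n m * row_sum ^ (n * zdeg n m - zweight n m))) (zdeg n m))"
proof -
  interpret s: ring_morphism "scroll_param n" by (rule ring_morphism_scroll_param)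
  have xy: "scroll_param n (xy_part f m) = [:xy_part f m:]" for m
    by (simp add: xy_part_def s.map_simps scroll_param_simps const_poly_power)
  have z: "scroll_param n (\<Prod>i<Suc n. zvar i ^ Poly_Mapping.lookup m (i + 3)) =
      monom (row_prod ^ zweight n m * row_sum ^ (n * zdeg n m - zweight n m)) (zdeg n m)" for m
  proof -
    have "scroll_param n (\<Prod>i<Suc n. zvar i ^ Poly_Mapping.lookup m (i + 3)) =
      (\<Prod>i<Suc n. monom ((row_prod ^ i * row_sum ^ (n - i)) ^ Poly_Mapping.lookup m (i + 3))
        (Poly_Mapping.lookup m (i + 3)))"
      unfolding s.map_prod s.map_power scroll_param_simps monom_power by simp
    also have "\<dots> = monom (\<Prod>i<Suc n. (row_prod ^ i * row_sum ^ (n - i)) ^ Poly_Mapping.lookup m (i + 3)) (zdeg n m)"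
      by (simp only: monom_prod finite_lessThan zdeg_def)
    also have "(\<Prod>i<Suc n. (row_prod ^ i * row_sum ^ (n - i)) ^ Poly_Mapping.lookup m (i + 3)) =
      row_prod ^ zweight n m * row_sum ^ (\<Sum>i<Suc n. (n - i) * Poly_Mapping.lookup m (i + 3))"
      by (simp only: power_mult_distrib prod.distrib power_sum zweight_def flip: power_mult)
    also have "(\<Sum>i<Suc n. (n - i) * Poly_Mapping.lookup m (i + 3)) = n * zdeg n m - zweight n m"
      using zcoweight[of n m] by simp
    finally show ?thesis .
  qed
  have "scroll_param n f = (\<Sum>m\<in>Poly_Mapping.keys f. scroll_param n
      (xy_part f m * (\<Prod>i<Suc n. zvar i ^ Poly_Mapping.lookup m (i + 3))))"
    unfolding s.map_sum[symmetric] Pol_expansion[OF assms, symmetric] ..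
  also have "\<dots> = (\<Sum>m\<in>Poly_Mapping.keys f.
    monom (xy_part f m * (row_prod ^ zweight n m * row_sum ^ (n * zdeg n m - zweight n m))) (zdeg n m))"
    unfolding s.map_mult xy z by (simp add: smult_monom)
  finally show ?thesis .
qed

lemma minor_cong_expansion:
  assumes "f \<in> Pol (n + 3)"
  shows "minor_cong n f (\<Sum>m\<in>Poly_Mapping.keys f. xy_part f m * zmono n (zdeg n m) (zweight n m))"
proof -
  have "minor_cong n
      (\<Sum>m\<in>Poly_Mapping.keys f. xy_part f m * (\<Prod>i<Suc n. zvar i ^ Poly_Mapping.lookup m (i + 3)))
      (\<Sum>m\<in>Poly_Mapping.keys f. xy_part f m * zmono n (zdeg n m) (zweight n m))"
    unfolding zdeg_def zweight_def
    by (intro minor_cong_sum minor_cong_mult Pol_xy_part zvar_prod_zmono) simp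
  then show ?thesis by (simp only: Pol_expansion[OF assms, symmetric])
qed

text \<open>Modulo the ideal, \<open>f\<close> is a combination of standard monomials with coefficients in \<open>x, y\<close>.  The
  coefficient of \<open>t\<^sup>c\<close> in the value of the parametrisation is the relation that puts the part of
  degree \<open>c\<close> into the ideal.\<close>

lemma kernel_scroll_param_subset:
  assumes f: "f \<in> Pol (n + 3)" and zero: "scroll_param n f = 0"
  shows "f \<in> minor_ideal n"
proof (rule minor_cong_minor_ideal[OF minor_cong_expansion[OF f]])
  let ?K = "Poly_Mapping.keys f"
  have homogeneous: "(\<Sum>m\<in>{m \<in> ?K. zdeg n m = c}. xy_part f m * zmono n (zdeg n m) (zweight n m)) \<in> minor_ideal n" for c
  proof -
    define F where "F j = (\<Sum>m\<in>{m \<in> {m \<in> ?K. zdeg n m = c}. zweight n m = j}. xy_part f m)" for j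
    have wt: "zweight n ` {m \<in> ?K. zdeg n m = c} \<subseteq> {..n * c}"
    proof (rule image_subsetI)
      fix m assume "m \<in> {m \<in> ?K. zdeg n m = c}"
      then show "zweight n m \<in> {..n * c}" using zcoweight[of n m] by simp
    qed
    have group: "(\<Sum>m\<in>{m \<in> ?K. zdeg n m = c}. xy_part f m * h (zweight n m)) = (\<Sum>j\<le>n * c. F j * h j)" for h
    proof -
      have "(\<Sum>m\<in>{m \<in> ?K. zdeg n m = c}. xy_part f m * h (zweight n m)) =
        (\<Sum>j\<le>n * c. \<Sum>m\<in>{m \<in> {m \<in> ?K. zdeg n m = c}. zweight n m = j}. xy_part f m * h (zweight n m))"
        by (rule sum.group[OF _ _ wt, symmetric]) simp_all
      also have "\<dots> = (\<Sum>j\<le>n * c. F j * h j)"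
        unfolding F_def sum_distrib_right by (intro sum.cong) auto
      finally show ?thesis .
    qed
    have "0 = coeff (scroll_param n f) c" by (simp add: zero)
    also have "\<dots> = (\<Sum>m\<in>?K. if zdeg n m = c
        then xy_part f m * (row_prod ^ zweight n m * row_sum ^ (n * zdeg n m - zweight n m)) else 0)"
      unfolding scroll_param_expansion[OF f] coeff_sum coeff_monom by (intro sum.cong) auto
    also have "\<dots> = (\<Sum>m\<in>{m \<in> ?K. zdeg n m = c}. xy_part f m * (row_prod ^ zweight n m * row_sum ^ (n * c - zweight n m)))"
      by (subst sum.inter_filter) (auto intro!: sum.cong)
    also have "\<dots> = (\<Sum>j\<le>n * c. F j * (row_prod ^ j * row_sum ^ (n * c - j)))"
      by (rule group)
    finally have "(\<Sum>j\<le>n * c. F j * row_prod ^ j * row_sum ^ (n * c - j)) = 0"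
      by (simp only: mult.assoc)
    moreover have "F j \<in> Pol (n + 3)" for j
      unfolding F_def by (intro Pol_sum Pol_xy_part)
    ultimately have "(\<Sum>j\<le>n * c. F j * zmono n c j) \<in> minor_ideal n"
      by (intro homogeneous_relation_in_minor_ideal) simp_all
    then have "(\<Sum>m\<in>{m \<in> ?K. zdeg n m = c}. xy_part f m * zmono n c (zweight n m)) \<in> minor_ideal n"
      by (simp only: group)
    also have "(\<Sum>m\<in>{m \<in> ?K. zdeg n m = c}. xy_part f m * zmono n c (zweight n m)) =
        (\<Sum>m\<in>{m \<in> ?K. zdeg n m = c}. xy_part f m * zmono n (zdeg n m) (zweight n m))"
      by (rule sum.cong) simp_all
    finally show ?thesis .
  qed
  have "(\<Sum>c\<in>zdeg n ` ?K. \<Sum>m\<in>{m \<in> ?K. zdeg n m = c}. xy_part f m * zmono n (zdeg n m) (zweight n m)) \<in> minor_ideal n"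
    by (intro minor_ideal_sum homogeneous)
  also have "(\<Sum>c\<in>zdeg n ` ?K. \<Sum>m\<in>{m \<in> ?K. zdeg n m = c}. xy_part f m * zmono n (zdeg n m) (zweight n m)) =
    (\<Sum>m\<in>?K. xy_part f m * zmono n (zdeg n m) (zweight n m))"
    by (rule sum.group) simp_all
  finally show "(\<Sum>m\<in>?K. xy_part f m * zmono n (zdeg n m) (zweight n m)) \<in> minor_ideal n" .
qed

lemma parametrised_vanishes_on_minor_ideal:
  assumes "ring_morphism h"
    and z: "\<And>i. i \<le> n \<Longrightarrow> h (zvar i) = h row_prod ^ i * h row_sum ^ (n - i) * t"
    and "f \<in> minor_ideal n"
  shows "h f = 0"
proof (rule vanishes_on_minor_ideal[OF assms(1) _ _ assms(3)])
  fix i assume "i < n"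
  then have "n - i = Suc (n - Suc i)" by simp
  then show "h row_sum * h (zvar (Suc i)) = h (zvar i) * h row_prod"
    using z[of i] z[of "Suc i"] \<open>i < n\<close> by (simp add: mult_ac del: add_Suc)
next
  fix i j assume ij: "i < j" "j < n"
  then have "n - i = Suc (n - Suc i)" "n - j = Suc (n - Suc j)" by simp_all
  then show "h (zvar i) * h (zvar (Suc j)) = h (zvar j) * h (zvar (Suc i))"
    using z[of i] z[of "Suc i"] z[of j] z[of "Suc j"] ij by (simp add: mult_ac del: add_Suc)
qed

section \<open>Prime chains and quotients\<close>

lemma carrier_Quot: "carrier (R Quot I) = (\<lambda>a. I +>\<^bsub>R\<^esub> a) ` carrier R"
  by (auto simp: FactRing_def A_RCOSETS_def')

lemma zero_Quot: "\<zero>\<^bsub>R Quot I\<^esub> = I"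
  by (simp add: FactRing_def)

lemma (in cring) quotient_image_mem_iff:
  assumes "ideal I R" "ideal J R" "I \<subseteq> J" "a \<in> carrier R"
  shows "I +> a \<in> (+>) I ` J \<longleftrightarrow> a \<in> J"
proof -
  have sub: "(+>) I ` J \<subseteq> carrier (R Quot I)"
    using ring_ideal_imp_quot_ideal[OF assms(1,2)]
    by (rule additive_subgroup.a_subset[OF ideal.axioms(1)])
  have "\<Union> ((+>) I ` J) = J"
    using ideal_incl_iff[OF assms(1,2)] assms(3) by simp
  then show ?thesis
    using canonical_proj_vimage_mem_iff[OF assms(1) sub assms(4)] by simp
qed

lemma (in cring) primeideal_quotient_image:
  assumes "ideal I R" "primeideal P R" "I \<subseteq> P"
  shows "primeideal ((+>) I ` P) (R Quot I)"
proof (rule primeidealI)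
  interpret P: primeideal P R by fact
  interpret I: ideal I R by fact
  note mem = quotient_image_mem_iff[OF assms(1) P.is_ideal assms(3)]
  show "ideal ((+>) I ` P) (R Quot I)"
    by (rule ring_ideal_imp_quot_ideal[OF assms(1) P.is_ideal])
  show "cring (R Quot I)" by (rule I.quotient_is_cring[OF is_cring])
  have carr: "\<exists>a\<in>carrier R. A = I +> a" if "A \<in> carrier (R Quot I)" for A
    using that unfolding carrier_Quot by blast
  have in_carr: "I +> a \<in> carrier (R Quot I)" if "a \<in> carrier R" for a
    using that unfolding carrier_Quot by blast
  obtain a where "a \<in> carrier R" "a \<notin> P"
    using P.I_notcarr P.a_subset by blast
  then have "I +> a \<in> carrier (R Quot I)" "I +> a \<notin> (+>) I ` P"
    by (simp_all only: in_carr mem not_False_eq_True)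
  then show "carrier (R Quot I) \<noteq> (+>) I ` P" by metis
  show "A \<in> (+>) I ` P \<or> B \<in> (+>) I ` P"
    if A: "A \<in> carrier (R Quot I)" and B: "B \<in> carrier (R Quot I)"
      and AB: "A \<otimes>\<^bsub>R Quot I\<^esub> B \<in> (+>) I ` P" for A B
  proof -
    obtain a b where ab: "a \<in> carrier R" "A = I +> a" "b \<in> carrier R" "B = I +> b"
      using carr[OF A] carr[OF B] by blast
    have "I +> (a \<otimes> b) \<in> (+>) I ` P"
      using AB ab ring_hom_mult[OF I.rcos_ring_hom, of a b] by simp
    then have "a \<otimes> b \<in> P" using mem ab by simp
    then show ?thesis using P.I_prime[of a b] mem ab by blast
  qed
qed

lemma (in cring) prime_chain_quotient_image:
  assumes "ideal I R" "prime_chain R C k" "I \<subseteq> C 0"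
  shows "prime_chain (R Quot I) (\<lambda>i. (+>) I ` C i) k"
proof -
  have prime: "primeideal (C i) R" if "i \<le> k" for i
    using assms(2) that by (simp add: prime_chain_def)
  have strict: "C i \<subset> C (Suc i)" if "i < k" for i
    using assms(2) that by (simp add: prime_chain_def)
  have I: "I \<subseteq> C i" if "i \<le> k" for i
    using that by (induction i) (use assms(3) strict in \<open>auto simp: less_eq_Suc_le\<close>)
  have "(+>) I ` C i \<subset> (+>) I ` C (Suc i)" if i: "i < k" for i
  proof -
    have le: "i \<le> k" "Suc i \<le> k" using i by auto
    obtain a where a: "a \<in> C (Suc i)" "a \<notin> C i" using strict[OF i] by blast
    interpret Q: primeideal "C (Suc i)" R by (rule prime[OF le(2)])
    have "a \<in> carrier R" using a(1) Q.a_subset by blast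
    then have "I +> a \<notin> (+>) I ` C i"
      using quotient_image_mem_iff[OF assms(1) primeideal.axioms(1)[OF prime[OF le(1)]] I[OF le(1)]] a(2) by blast
    then show ?thesis using strict[OF i] a(1) by blast
  qed
  then show ?thesis
    using primeideal_quotient_image[OF assms(1) prime I] by (simp add: prime_chain_def)
qed

lemma (in cring) prime_chain_quotient_preimage:
  assumes "ideal I R" "prime_chain (R Quot I) E k"
  obtains D where "prime_chain R D k" "I \<subseteq> D 0"
proof -
  interpret I: ideal I R by fact
  interpret h: ring_hom_ring R "R Quot I" "(+>) I" by (rule I.rcos_ring_hom_ring)
  define D where "D i = {r \<in> carrier R. I +> r \<in> E i}" for i
  have prime: "primeideal (E i) (R Quot I)" if "i \<le> k" for i
    using assms(2) that by (simp add: prime_chain_def)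
  have strict: "E i \<subset> E (Suc i)" if "i < k" for i
    using assms(2) that by (simp add: prime_chain_def)
  have "D i \<subset> D (Suc i)" if i: "i < k" for i
  proof -
    obtain A where A: "A \<in> E (Suc i)" "A \<notin> E i" using strict[OF i] by blast
    have "primeideal (E (Suc i)) (R Quot I)" using prime[of "Suc i"] i by simp
    then interpret Q: primeideal "E (Suc i)" "R Quot I" .
    have "A \<in> carrier (R Quot I)" using A(1) Q.a_subset by blast
    then obtain a where a: "a \<in> carrier R" "A = I +> a"
      unfolding carrier_Quot by blast
    then have "a \<in> D (Suc i)" "a \<notin> D i" using A unfolding D_def a(2) using a(1) by blast+
    moreover have "D i \<subseteq> D (Suc i)" using strict[OF i] unfolding D_def by blast
    ultimately show ?thesis by blast
  qed
  moreover have "primeideal (D i) R" if "i \<le> k" for i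
    unfolding D_def by (rule h.primeideal_vimage[OF is_cring prime[OF that]])
  ultimately have "prime_chain R D k" by (simp add: prime_chain_def)
  moreover have "I \<subseteq> D 0"
  proof
    fix a assume a: "a \<in> I"
    interpret Q: primeideal "E 0" "R Quot I" by (rule prime) simp
    have "I \<in> E 0"
      using additive_subgroup.zero_closed[OF Q.is_additive_subgroup] unfolding zero_Quot .
    moreover have "I +> a = I" using a by (rule I.a_rcos_const)
    moreover have "a \<in> carrier R" using a I.a_subset by blast
    ultimately show "a \<in> D 0" unfolding D_def by (simp only: mem_Collect_eq)
  qed
  ultimately show ?thesis by (rule that)
qed

lemma prime_chain_append:
  assumes "prime_chain R C k" "prime_chain R D l" "C k \<subseteq> D 0"
  shows "prime_chain R (\<lambda>i. if i < k then C i else D (i - k)) (k + l)"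
  unfolding prime_chain_def
proof (intro conjI allI impI)
  fix i assume "i \<le> k + l"
  then show "primeideal (if i < k then C i else D (i - k)) R"
    using assms(1,2) by (auto simp: prime_chain_def)
next
  fix i assume i: "i < k + l"
  consider "Suc i < k" | "Suc i = k" | "k \<le> i" by linarith
  then show "(if i < k then C i else D (i - k)) \<subset> (if Suc i < k then C (Suc i) else D (Suc i - k))"
  proof cases
    case 1
    then show ?thesis using assms(1) by (simp add: prime_chain_def)
  next
    case 2
    then have "C i \<subset> C k" using assms(1) by (auto simp: prime_chain_def)
    then show ?thesis using 2 assms(3) by auto
  next
    case 3
    then have "i - k < l" "Suc i - k = Suc (i - k)" using i by auto
    then show ?thesis using 3 assms(2) by (simp add: prime_chain_def)
  qed
qed

lemma prime_height_ge: "prime_chain R C k \<Longrightarrow> C k = P \<Longrightarrow> enat k \<le> prime_height R P"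
  unfolding prime_height_def by (rule SUP_upper) blast

lemma prime_height_le:
  "(\<And>C k. prime_chain R C k \<Longrightarrow> C k = P \<Longrightarrow> enat k \<le> b) \<Longrightarrow> prime_height R P \<le> b"
  unfolding prime_height_def by (rule SUP_least) blast

lemma krull_dim_ge: "prime_chain R C k \<Longrightarrow> enat k \<le> krull_dim R"
  unfolding krull_dim_def by (rule SUP_upper) blast

lemma krull_dim_le: "(\<And>C k. prime_chain R C k \<Longrightarrow> enat k \<le> b) \<Longrightarrow> krull_dim R \<le> b"
  unfolding krull_dim_def by (rule SUP_least) blast

lemma prime_height_le_krull_dim: "prime_height R P \<le> krull_dim R"
  by (rule prime_height_le) (rule krull_dim_ge)

lemma prime_height_mono:
  assumes "primeideal P R" "primeideal Q R" "P \<subseteq> Q"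
  shows "prime_height R P \<le> prime_height R Q"
proof (cases "P = Q")
  case False
  show ?thesis
  proof (rule prime_height_le)
    fix C k assume C: "prime_chain R C k" "C k = P"
    have "prime_chain R (C(Suc k := Q)) (Suc k)"
      unfolding prime_chain_def
    proof (intro conjI allI impI)
      fix i assume "i \<le> Suc k"
      then show "primeideal ((C(Suc k := Q)) i) R"
        using C(1) assms(2) by (cases "i = Suc k") (auto simp: prime_chain_def)
    next
      fix i assume "i < Suc k"
      then show "(C(Suc k := Q)) i \<subset> (C(Suc k := Q)) (Suc i)"
        using C assms(3) False by (cases "i = k") (auto simp: prime_chain_def)
    qed
    from prime_height_ge[OF this] have "enat (Suc k) \<le> prime_height R Q" by simp
    then show "enat k \<le> prime_height R Q" by (rule order_trans[rotated]) simp
  qed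
qed simp

text \<open>Heights grow along inclusions, so the infimum over the primes containing \<open>P\<close> is attained at \<open>P\<close>.\<close>

lemma ideal_codim_primeideal:
  assumes "primeideal P R"
  shows "ideal_codim R P = prime_height R P"
  unfolding ideal_codim_def
proof (rule antisym)
  show "(INF Q\<in>{Q. primeideal Q R \<and> P \<subseteq> Q}. prime_height R Q) \<le> prime_height R P"
    using assms by (intro INF_lower) simp
  show "prime_height R P \<le> (INF Q\<in>{Q. primeideal Q R \<and> P \<subseteq> Q}. prime_height R Q)"
    by (rule INF_greatest) (use prime_height_mono[OF assms] in simp)
qed


section \<open>A full flag of primes through the determinantal ideal\<close>

lemma primeideal_subst_kernel:
  fixes g :: "nat \<Rightarrow> cpoly"
  shows "primeideal {f \<in> Pol N. subst scalar g f = 0} (polynomial_ring N)"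
proof -
  interpret s: ring_morphism "subst scalar g" by (rule ring_morphism_subst[OF ring_morphism_scalar])
  show ?thesis by (rule primeideal_PolI) (auto simp: s.map_simps Pol_closed)
qed

lemma subst_kernel_mono:
  fixes g g' s :: "nat \<Rightarrow> cpoly"
  assumes "\<And>i. i \<in> {1..N} \<Longrightarrow> g' i = subst scalar s (g i)"
  shows "{f \<in> Pol N. subst scalar g f = 0} \<subseteq> {f \<in> Pol N. subst scalar g' f = 0}"
proof clarify
  fix f assume f: "f \<in> Pol N" "subst scalar g f = 0"
  interpret s: ring_morphism "subst scalar s" by (rule ring_morphism_subst[OF ring_morphism_scalar])
  have "subst scalar s (subst scalar g f) = subst scalar (subst scalar s \<circ> g) f"
    using subst_comp[OF s.ring_morphism_axioms, of scalar g f]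
    by (simp add: comp_def subst_scalar[OF ring_morphism_scalar])
  also have "\<dots> = subst scalar g' f"
    by (rule subst_cong_on[OF f(1)]) (simp add: assms)
  finally show "subst scalar g' f = 0" by (simp add: f(2) s.map_zero)
qed

text \<open>Generic points of a descending chain of irreducible subvarieties.  For \<open>k \<le> n\<close> the coordinates
  \<open>z\<^sub>0, \<dots>, z\<^sub>k\<close> are bound to the parametrisation, with \<open>pvar 3\<close> as the parameter \<open>t\<close>, and the others are free.
  After that, first all \<open>z\<^sub>i\<close>, then \<open>y\<close>, then \<open>x\<close> are set to zero.\<close>

definition flag_point :: "nat \<Rightarrow> nat \<Rightarrow> nat \<Rightarrow> cpoly"
  where "flag_point n k i =
    (if i < 3 then (if i + k \<le> n + 3 then pvar i else 0)
     else if k \<le> n then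
       (if i - 3 \<le> k then row_prod ^ (i - 3) * row_sum ^ (n - (i - 3)) * pvar 3 else pvar i)
     else 0)"

definition flag :: "nat \<Rightarrow> nat \<Rightarrow> cpoly set"
  where "flag n k = {f \<in> Pol (n + 3). subst scalar (flag_point n k) f = 0}"

lemma flag_minor_ideal: "flag n n = minor_ideal n"
proof
  interpret s: ring_morphism "subst scalar (flag_point n n)"
    by (rule ring_morphism_subst[OF ring_morphism_scalar])
  show "minor_ideal n \<subseteq> flag n n"
  proof
    fix f assume f: "f \<in> minor_ideal n"
    have "subst scalar (flag_point n n) f = 0"
      by (rule parametrised_vanishes_on_minor_ideal[OF s.ring_morphism_axioms _ f, where t = "pvar 3"])
        (simp add: s.map_simps subst_pvar[OF ring_morphism_scalar] flag_point_def)
    then show "f \<in> flag n n" using f minor_ideal_Pol by (auto simp: flag_def)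
  qed
  show "flag n n \<subseteq> minor_ideal n"
  proof
    fix f assume f: "f \<in> flag n n"
    define g where "g i = (if i = 3 then [:0, 1:] else [:pvar i:])" for i :: nat
    interpret t: ring_morphism "subst (\<lambda>c. [:scalar c :: cpoly:]) g"
      by (rule ring_morphism_subst[OF ring_morphism_const_scalar])
    have "0 = subst (\<lambda>c. [:scalar c:]) g (subst scalar (flag_point n n) f)"
      using f by (simp add: flag_def t.map_zero)
    also have "\<dots> = subst (\<lambda>c. [:scalar c:]) (subst (\<lambda>c. [:scalar c:]) g \<circ> flag_point n n) f"
      using subst_comp[OF t.ring_morphism_axioms, of scalar "flag_point n n" f]
      by (simp add: comp_def subst_scalar[OF ring_morphism_const_scalar])
    also have "\<dots> = scroll_param n f"
      unfolding scroll_param_def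
    proof (rule subst_cong_on)
      show "f \<in> Pol (n + 3)" using f by (simp add: flag_def)
      fix i assume i: "i \<in> {1..n + 3}"
      show "(subst (\<lambda>c. [:scalar c:]) g \<circ> flag_point n n) i =
        (if i < 3 then [:pvar i:] else monom (row_prod ^ (i - 3) * row_sum ^ (n - (i - 3))) 1)"
        using i by (auto simp: flag_point_def t.map_simps subst_pvar[OF ring_morphism_const_scalar] g_def
            const_poly_power monom_altdef mult_ac)
    qed
    finally show "f \<in> minor_ideal n" using f kernel_scroll_param_subset by (simp add: flag_def)
  qed
qed

text \<open>Each generic point is a specialisation of the preceding one, which gives the inclusion.  The
  polynomials witnessing strictness are the minor \<open>(x + y) z\<^sub>k\<^sub>+\<^sub>1 - xy z\<^sub>k\<close> for \<open>k < n\<close>, then \<open>z\<^sub>0\<close>, \<open>y\<close> and \<open>x\<close>.\<close>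

lemma flag_strict:
  assumes "k < n + 3"
  shows "flag n k \<subset> flag n (Suc k)"
proof -
  note sp = subst_pvar[OF ring_morphism_scalar]
  consider (low) "k < n" | (apex) "k = n" | (line) "k = n + 1" | (point) "k = n + 2"
    using assms by linarith
  then show ?thesis
  proof cases
    case low
    define s where "s = pvar(k + 4 := row_prod ^ Suc k * row_sum ^ (n - Suc k) * pvar 3)"
    interpret s: ring_morphism "subst scalar s" by (rule ring_morphism_subst[OF ring_morphism_scalar])
    have sv: "subst scalar s (pvar i) = s i" for i by (rule sp)
    have sub: "flag n k \<subseteq> flag n (Suc k)"
      unfolding flag_def
    proof (rule subst_kernel_mono)
      fix i
      show "flag_point n (Suc k) i = subst scalar s (flag_point n k i)"
      proof (cases "i = k + 4")
        case True
        then show ?thesis using low by (simp add: flag_point_def sv) (simp add: s_def)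
      next
        case False
        moreover have "s j = pvar j" if "j \<noteq> k + 4" for j
          using that by (simp add: s_def)
        ultimately show ?thesis
          using low by (auto simp: flag_point_def s.map_simps sv le_Suc_eq)
      qed
    qed
    define f where "f = row_sum * zvar (Suc k) - row_prod * zvar k"
    have fP: "f \<in> Pol (n + 3)"
      unfolding f_def using low by (intro Pol_diff Pol_mult Pol_add Pol_mirror_vars) auto
    have val: "subst scalar (flag_point n l) f =
      row_sum * flag_point n l (Suc k + 3) - row_prod * flag_point n l (k + 3)" if "l \<le> n" for l
    proof -
      interpret l: ring_morphism "subst scalar (flag_point n l)"
        by (rule ring_morphism_subst[OF ring_morphism_scalar])
      show ?thesis
        using that by (simp add: f_def l.map_simps sp) (simp add: flag_point_def)
    qed
    have "n - k = Suc (n - Suc k)" using low by simp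
    then have "subst scalar (flag_point n (Suc k)) f = 0"
      using low by (simp add: val) (simp add: flag_point_def mult_ac)
    moreover have "subst scalar (flag_point n k) f \<noteq> 0"
    proof
      assume zero: "subst scalar (flag_point n k) f = 0"
      \<comment> \<open>At this point the first term of the value vanishes and the second one is a power of \<open>2\<close>.\<close>
      define e where "e i = (if i = k + 4 then 0 else 1 :: complex)" for i
      interpret e: ring_morphism "subst id e" by (rule ring_morphism_subst[OF ring_morphism_id])
      have "subst scalar (flag_point n k) f =
          row_sum * pvar (k + 4) - row_prod * (row_prod ^ k * row_sum ^ (n - k) * pvar 3)"
      proof -
        have "Suc k + 3 = k + 4" by simp
        moreover have "flag_point n k (k + 4) = pvar (k + 4)"
          using low by (simp add: flag_point_def)
        moreover have "flag_point n k (k + 3) = row_prod ^ k * row_sum ^ (n - k) * pvar 3"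
          using low by (simp add: flag_point_def)
        ultimately show ?thesis using low val[of k] by (simp add: add.commute)
      qed
      then have "subst id e (row_sum * pvar (k + 4) - row_prod * (row_prod ^ k * row_sum ^ (n - k) * pvar 3)) = 0"
        by (simp add: zero e.map_zero)
      moreover have "subst id e (pvar i) = e i" for i by (rule subst_pvar[OF ring_morphism_id])
      ultimately have "(e 1 + e 2) * e (k + 4) - e 1 * e 2 * ((e 1 * e 2) ^ k * (e 1 + e 2) ^ (n - k) * e 3) = 0"
        by (simp only: e.map_simps)
      then show False by (simp add: e_def)
    qed
    ultimately show ?thesis using sub fP by (auto simp: flag_def)
  next
    case apex
    define s where "s = pvar(3 := 0)"
    interpret s: ring_morphism "subst scalar s" by (rule ring_morphism_subst[OF ring_morphism_scalar])
    have sv: "subst scalar s (pvar i) = s i" for i by (rule sp)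
    have sub: "flag n k \<subseteq> flag n (Suc k)"
      unfolding flag_def
    proof (rule subst_kernel_mono)
      fix i assume "i \<in> {1..n + 3}"
      then show "flag_point n (Suc k) i = subst scalar s (flag_point n k i)"
        using apex by (auto simp: flag_point_def s.map_simps sv) (simp_all add: s_def)
    qed
    have "pvar 3 \<in> Pol (n + 3)" by (rule Pol_pvar) simp
    moreover have "subst scalar (flag_point n (Suc k)) (pvar 3) = 0"
      using apex by (simp add: sp flag_point_def)
    moreover have "subst scalar (flag_point n k) (pvar 3) \<noteq> 0"
      using apex row_sum_nonzero by (simp add: sp flag_point_def pvar_nonzero)
    ultimately show ?thesis using sub by (auto simp: flag_def)
  next
    case line
    define s where "s = pvar(2 := 0)"
    interpret s: ring_morphism "subst scalar s" by (rule ring_morphism_subst[OF ring_morphism_scalar])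
    have sv: "subst scalar s (pvar i) = s i" for i by (rule sp)
    have sub: "flag n k \<subseteq> flag n (Suc k)"
      unfolding flag_def
    proof (rule subst_kernel_mono)
      fix i assume "i \<in> {1..n + 3}"
      then show "flag_point n (Suc k) i = subst scalar s (flag_point n k i)"
        using line by (auto simp: flag_point_def s.map_simps sv) (simp_all add: s_def)
    qed
    have "pvar 2 \<in> Pol (n + 3)" by (rule Pol_pvar) simp
    moreover have "subst scalar (flag_point n (Suc k)) (pvar 2) = 0"
      using line by (simp add: sp flag_point_def)
    moreover have "subst scalar (flag_point n k) (pvar 2) \<noteq> 0"
      using line by (simp add: sp flag_point_def pvar_nonzero)
    ultimately show ?thesis using sub by (auto simp: flag_def)
  next
    case point
    define s where "s = pvar(1 := 0)"
    interpret s: ring_morphism "subst scalar s" by (rule ring_morphism_subst[OF ring_morphism_scalar])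
    have sv: "subst scalar s (pvar i) = s i" for i by (rule sp)
    have sub: "flag n k \<subseteq> flag n (Suc k)"
      unfolding flag_def
    proof (rule subst_kernel_mono)
      fix i assume "i \<in> {1..n + 3}"
      then show "flag_point n (Suc k) i = subst scalar s (flag_point n k i)"
        using point by (auto simp: flag_point_def s.map_simps sv) (simp_all add: s_def)
    qed
    have "pvar 1 \<in> Pol (n + 3)" by (rule Pol_pvar) simp
    moreover have "subst scalar (flag_point n (Suc k)) (pvar 1) = 0"
      using point by (simp add: sp flag_point_def)
    moreover have "subst scalar (flag_point n k) (pvar 1) \<noteq> 0"
      using point by (simp add: sp flag_point_def pvar_nonzero)
    ultimately show ?thesis using sub by (auto simp: flag_def)
  qed
qed

lemma primeideal_flag: "primeideal (flag n k) (polynomial_ring (n + 3))"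
  unfolding flag_def by (rule primeideal_subst_kernel)

lemma prime_chain_flag: "j + k \<le> n + 3 \<Longrightarrow> prime_chain (polynomial_ring (n + 3)) (\<lambda>i. flag n (j + i)) k"
  unfolding prime_chain_def using flag_strict[of "j + i" n for i] by (simp add: primeideal_flag)

lemma primeideal_minor_ideal: "primeideal (minor_ideal n) (polynomial_ring (n + 3))"
  using primeideal_flag[of n n] by (simp add: flag_minor_ideal)

lemma domain_mirror_coordinate_ring: "domain (polynomial_ring (n + 3) Quot minor_ideal n)"
  by (rule primeideal.quotient_is_domain[OF primeideal_minor_ideal])

text \<open>A chain of length \<open>k\<close> ending at the ideal continues upwards along the flag by three more steps.\<close>

lemma minor_ideal_codim: "ideal_codim (polynomial_ring (n + 3)) (minor_ideal n) = enat n"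
  unfolding ideal_codim_primeideal[OF primeideal_minor_ideal]
proof (rule antisym)
  show "enat n \<le> prime_height (polynomial_ring (n + 3)) (minor_ideal n)"
    by (rule prime_height_ge[OF prime_chain_flag[of 0]]) (simp_all add: flag_minor_ideal)
  show "prime_height (polynomial_ring (n + 3)) (minor_ideal n) \<le> enat n"
  proof (rule prime_height_le)
    fix C k assume C: "prime_chain (polynomial_ring (n + 3)) C k" "C k = minor_ideal n"
    have "prime_chain (polynomial_ring (n + 3)) (\<lambda>i. flag n (n + i)) 3"
      by (rule prime_chain_flag) simp
    then have "k + 3 \<le> n + 3"
      by (rule prime_chain_polynomial_ring_length[OF prime_chain_append[OF C(1)]])
        (simp add: flag_minor_ideal C(2))
    then show "enat k \<le> enat n" by simp
  qed
qed

text \<open>A chain in the quotient corresponds to one above the ideal, which the flag extends downwards by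
  \<open>n\<close> steps.\<close>

lemma mirror_krull_dim: "krull_dim (polynomial_ring (n + 3) Quot minor_ideal n) = 3"
proof (rule antisym)
  interpret cring "polynomial_ring (n + 3)" by (rule cring_polynomial_ring)
  have "prime_chain (polynomial_ring (n + 3)) (\<lambda>i. flag n (n + i)) 3"
    by (rule prime_chain_flag) simp
  from krull_dim_ge[OF prime_chain_quotient_image[OF ideal_minor_ideal this]]
  show "3 \<le> krull_dim (polynomial_ring (n + 3) Quot minor_ideal n)"
    by (simp add: flag_minor_ideal numeral_eq_enat)
  show "krull_dim (polynomial_ring (n + 3) Quot minor_ideal n) \<le> 3"
  proof (rule krull_dim_le)
    fix E k assume "prime_chain (polynomial_ring (n + 3) Quot minor_ideal n) E k"
    then obtain D where D: "prime_chain (polynomial_ring (n + 3)) D k" "minor_ideal n \<subseteq> D 0"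
      by (rule prime_chain_quotient_preimage[OF ideal_minor_ideal])
    have "prime_chain (polynomial_ring (n + 3)) (\<lambda>i. flag n (0 + i)) n"
      by (rule prime_chain_flag) simp
    then have "n + k \<le> n + 3"
      by (rule prime_chain_polynomial_ring_length[OF prime_chain_append[OF _ D(1)]])
        (simp add: flag_minor_ideal D(2))
    then show "enat k \<le> 3" by (simp add: numeral_eq_enat)
  qed
qed


section \<open>The mirror algebra as a quotient of the polynomial ring\<close>

abbreviation uvar :: laurent where "uvar \<equiv> laurent_monom (1, 0, 0)"
abbreviation vvar :: laurent where "vvar \<equiv> laurent_monom (0, 1, 0)"
abbreviation wvar :: laurent where "wvar \<equiv> laurent_monom (0, 0, 1)"

lemma laurent_monom_mult: "laurent_monom (a, b, c) * laurent_monom (a', b', c') = laurent_monom (a + a', b + b', c + c')"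
  by (simp add: laurent_monom_def mult_single)

lemma laurent_monom_zero: "laurent_monom (0, 0, 0) = 1"
  by (simp add: laurent_monom_def flip: zero_prod_def)

lemma laurent_monom_powers:
  "laurent_monom (int a, int b, int c) = uvar ^ a * vvar ^ b * wvar ^ c"
proof -
  have "uvar ^ a = laurent_monom (int a, 0, 0)"
    by (induction a) (simp_all add: laurent_monom_zero laurent_monom_mult)
  moreover have "vvar ^ b = laurent_monom (0, int b, 0)"
    by (induction b) (simp_all add: laurent_monom_zero laurent_monom_mult)
  moreover have "wvar ^ c = laurent_monom (0, 0, int c)"
    by (induction c) (simp_all add: laurent_monom_zero laurent_monom_mult)
  ultimately show ?thesis by (simp add: laurent_monom_mult)
qed

text \<open>The lattice point whose theta function is the \<open>i\<close>-th coordinate.\<close>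

definition theta_point :: "nat \<Rightarrow> nat \<Rightarrow> int \<times> int \<times> int"
  where "theta_point n i =
    (if i = 1 then (1, 1, 0) else if i = 2 then (0, 1, 0) else (int (i - 3), int (i - 3), 1))"

definition mirror_map :: "nat \<Rightarrow> cpoly \<Rightarrow> laurent"
  where "mirror_map n = subst scalar (\<lambda>i. theta n (theta_point n i))"

lemma ring_morphism_mirror_map: "ring_morphism (mirror_map n)"
  unfolding mirror_map_def by (rule ring_morphism_subst[OF ring_morphism_scalar])

lemma mirror_map_pvar: "mirror_map n (pvar i) = theta n (theta_point n i)"
  unfolding mirror_map_def by (rule subst_pvar[OF ring_morphism_scalar])

lemma mirror_map_scalar: "mirror_map n (scalar c) = scalar c"
  unfolding mirror_map_def by (rule subst_scalar[OF ring_morphism_scalar])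

lemma mirror_map_explicit:
  "mirror_map n (pvar 1) = uvar * vvar * (1 + uvar)"
  "mirror_map n (pvar 2) = vvar * (1 + uvar)"
  "i \<le> n \<Longrightarrow> mirror_map n (zvar i) = (uvar * vvar) ^ i * wvar"
proof -
  show "mirror_map n (pvar 1) = uvar * vvar * (1 + uvar)"
    by (simp add: mirror_map_pvar theta_point_def theta_def laurent_monom_mult)
  show "mirror_map n (pvar 2) = vvar * (1 + uvar)"
    by (simp add: mirror_map_pvar theta_point_def theta_def)
  show "i \<le> n \<Longrightarrow> mirror_map n (zvar i) = (uvar * vvar) ^ i * wvar"
    using laurent_monom_powers[of i i 1]
    by (simp add: mirror_map_pvar theta_point_def theta_def power_mult_distrib)
qed

lemma mirror_map_minor_ideal:
  assumes "f \<in> minor_ideal n"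
  shows "mirror_map n f = 0"
proof (rule vanishes_on_minor_ideal[OF ring_morphism_mirror_map _ _ assms])
  interpret m: ring_morphism "mirror_map n" by (rule ring_morphism_mirror_map)
  show "mirror_map n row_sum * mirror_map n (zvar (Suc i)) = mirror_map n (zvar i) * mirror_map n row_prod"
    if "i < n" for i
    using that mirror_map_explicit(3)[of "Suc i" n] mirror_map_explicit(3)[of i n]
    by (simp add: m.map_simps mirror_map_explicit(1,2) algebra_simps del: add_Suc)
  show "mirror_map n (zvar i) * mirror_map n (zvar (Suc j)) = mirror_map n (zvar j) * mirror_map n (zvar (Suc i))"
    if "i < j" "j < n" for i j
    using that mirror_map_explicit(3)[of "Suc i" n] mirror_map_explicit(3)[of i n]
      mirror_map_explicit(3)[of "Suc j" n] mirror_map_explicit(3)[of j n]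
    by (simp add: mult_ac del: add_Suc)
qed

lemma ring_morphism_Fract: "ring_morphism (\<lambda>a::'a::idom. Fract a 1)"
  by unfold_locales (simp_all add: One_fract_def)

text \<open>Solving the formulas for the theta functions for \<open>u, v, w\<close> gives elements of the fraction field of the
  ring of parameters.  Evaluating Laurent polynomials at them turns the theta functions into the
  parametrisation, so a relation between theta functions lies in its kernel.\<close>

lemma mirror_map_kernel_subset:
  assumes f: "f \<in> Pol (n + 3)" and zero: "mirror_map n f = 0"
  shows "f \<in> minor_ideal n"
proof -
  define emb :: "cpoly poly \<Rightarrow> cpoly poly fract" where "emb a = Fract a 1" for a
  interpret e: ring_morphism emb unfolding emb_def by (rule ring_morphism_Fract)
  have emb_inj: "emb a = 0 \<longleftrightarrow> a = 0" for a
    by (simp add: emb_def Zero_fract_def eq_fract)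
  define x where "x = emb [:pvar 1:]"
  define y where "y = emb [:pvar 2:]"
  define t where "t = emb [:0, 1:]"
  define s where "s = x + y"
  have s: "s = emb [:row_sum:]" by (simp add: s_def x_def y_def flip: e.map_add)
  have nz: "x \<noteq> 0" "y \<noteq> 0" "s \<noteq> 0" "t \<noteq> 0"
    using pvar_nonzero row_sum_nonzero by (simp_all add: s) (simp_all add: x_def y_def t_def emb_inj)
  define U where "U = x / y"
  define V where "V = y ^ 2 / s"
  define W where "W = s ^ n * t"
  have UVW: "U \<noteq> 0" "V \<noteq> 0" "W \<noteq> 0" using nz by (simp_all add: U_def V_def W_def)
  define ch :: "int \<times> int \<times> int \<Rightarrow> cpoly poly fract"
    where "ch = (\<lambda>(a, b, c). U powi a * V powi b * W powi c)"
  define \<iota> :: "complex \<Rightarrow> cpoly poly fract" where "\<iota> = emb \<circ> (\<lambda>c. [:scalar c:])"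
  interpret L: monoid_algebra_morphism \<iota> ch
  proof (intro_locales)
    show "ring_morphism \<iota>"
      unfolding \<iota>_def by (rule ring_morphism_comp[OF e.ring_morphism_axioms ring_morphism_const_scalar])
    show "monoid_algebra_morphism_axioms ch"
    proof
      show "ch 0 = 1" by (simp add: ch_def zero_prod_def)
      show "ch (p + q) = ch p * ch q" for p q
        using UVW by (cases p; cases q) (simp add: ch_def power_int_add mult_ac)
    qed
  qed
  define ev where "ev = linear_extension \<iota> ch"
  interpret ev: ring_morphism ev unfolding ev_def by (rule L.ring_morphism_linear_extension)
  have ev_monom: "ev (laurent_monom q) = ch q" for q
    unfolding ev_def laurent_monom_def by (simp add: L.linear_extension_single L.map_one)
  have ev_uvw: "ev uvar = U" "ev vvar = V" "ev wvar = W"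
    by (simp_all add: ev_monom ch_def)
  have ev_scalar: "ev (scalar c) = \<iota> c" for c
    unfolding ev_def scalar_def by (simp add: L.linear_extension_single L.char_zero)
  have point: "ev (theta n (theta_point n i)) =
      emb (if i < 3 then [:pvar i:] else monom (row_prod ^ (i - 3) * row_sum ^ (n - (i - 3))) 1)"
    if i: "i \<in> {1..n + 3}" for i
  proof -
    have one_U: "1 + U = s / y" using nz by (simp add: U_def s_def field_simps)
    consider "i = 1" | "i = 2" | j where "i = j + 3" "j \<le> n"
    proof -
      have "i = 1 \<or> i = 2 \<or> i = (i - 3) + 3 \<and> i - 3 \<le> n" using i by auto
      then show ?thesis using that by blast
    qed
    then show ?thesis
    proof cases
      case 1
      have "ev (mirror_map n (pvar 1)) = x"
        using nz by (simp add: mirror_map_explicit ev.map_simps ev_uvw one_U)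
          (simp add: U_def V_def power2_eq_square)
      then show ?thesis using 1 by (simp add: mirror_map_pvar x_def)
    next
      case 2
      have "ev (mirror_map n (pvar 2)) = y"
        using nz by (simp add: mirror_map_explicit ev.map_simps ev_uvw one_U)
          (simp add: V_def power2_eq_square)
      then show ?thesis using 2 by (simp add: mirror_map_pvar y_def)
    next
      case 3
      have "U * V = x * y / s" using nz by (simp add: U_def V_def power2_eq_square)
      then have "ev (mirror_map n (zvar j)) = (x * y / s) ^ j * (s ^ n * t)"
        using 3 by (simp add: mirror_map_explicit ev.map_simps ev_uvw W_def)
      also have "s ^ n = s ^ j * s ^ (n - j)" using 3 by (simp flip: power_add)
      also have "(x * y / s) ^ j * (s ^ j * s ^ (n - j) * t) = (x * y) ^ j * s ^ (n - j) * t"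
        using nz by (simp add: power_divide)
      also have "\<dots> = emb ([:row_prod:] ^ j * [:row_sum:] ^ (n - j) * [:0, 1:])"
        proof -
          have "[:row_prod:] = [:pvar 1:] * [:pvar 2:]" by simp
          then show ?thesis by (simp only: s x_def y_def t_def e.map_mult e.map_power)
        qed
      also have "[:row_prod:] ^ j * [:row_sum:] ^ (n - j) * [:0, 1:] = monom (row_prod ^ j * row_sum ^ (n - j)) 1"
        by (simp add: const_poly_power monom_altdef mult_ac)
      finally show ?thesis using 3 by (simp add: mirror_map_pvar)
    qed
  qed
  have "0 = ev (mirror_map n f)" by (simp add: zero ev.map_zero)
  also have "\<dots> = subst (ev \<circ> scalar) (ev \<circ> (\<lambda>i. theta n (theta_point n i))) f"
    unfolding mirror_map_def by (rule subst_comp[OF ev.ring_morphism_axioms])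
  also have "\<dots> = subst \<iota> (emb \<circ> (\<lambda>i. if i < 3 then [:pvar i:]
      else monom (row_prod ^ (i - 3) * row_sum ^ (n - (i - 3))) 1)) f"
  proof -
    have "ev \<circ> scalar = \<iota>" by (simp add: fun_eq_iff ev_scalar)
    then show ?thesis using point by (simp only:) (rule subst_cong_on[OF f], simp)
  qed
  also have "\<dots> = emb (scroll_param n f)"
    unfolding \<iota>_def scroll_param_def by (rule subst_comp[OF e.ring_morphism_axioms, symmetric])
  finally have "scroll_param n f = 0" using emb_inj by simp
  then show ?thesis by (rule kernel_scroll_param_subset[OF f])
qed

lemma sigma_points_iff:
  "(a, b, c) \<in> sigma_points n \<longleftrightarrow> 0 \<le> a \<and> 0 \<le> c \<and> a \<le> 2 * b \<and> a \<le> b + int n * c"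
proof -
  have "real_of_int a \<le> real_of_int b + real n * real_of_int c \<longleftrightarrow> a \<le> b + int n * c"
    by (metis of_int_add of_int_le_iff of_int_mult of_int_of_nat_eq)
  moreover have "real_of_int a \<le> 2 * real_of_int b \<longleftrightarrow> a \<le> 2 * b"
    by linarith
  ultimately show ?thesis by (simp add: sigma_points_def sigma_cone_def)
qed

context
  fixes n :: nat
begin

interpretation m: ring_morphism "mirror_map n" by (rule ring_morphism_mirror_map)

lemma image_mult: "f \<in> mirror_map n ` Pol (n + 3) \<Longrightarrow> g \<in> mirror_map n ` Pol (n + 3) \<Longrightarrow>
    f * g \<in> mirror_map n ` Pol (n + 3)"
  using Pol_mult by (auto simp flip: m.map_mult)

lemma image_diff: "f \<in> mirror_map n ` Pol (n + 3) \<Longrightarrow> g \<in> mirror_map n ` Pol (n + 3) \<Longrightarrow>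
    f - g \<in> mirror_map n ` Pol (n + 3)"
  using Pol_diff by (auto simp flip: m.map_diff)

lemma image_power: "f \<in> mirror_map n ` Pol (n + 3) \<Longrightarrow> f ^ k \<in> mirror_map n ` Pol (n + 3)"
  using Pol_power by (auto simp flip: m.map_power)

lemma image_vars:
  "uvar * vvar * (1 + uvar) \<in> mirror_map n ` Pol (n + 3)"
  "vvar * (1 + uvar) \<in> mirror_map n ` Pol (n + 3)"
  "i \<le> n \<Longrightarrow> (uvar * vvar) ^ i * wvar \<in> mirror_map n ` Pol (n + 3)"
  using imageI[OF Pol_mirror_vars(1), of "mirror_map n" n] imageI[OF Pol_mirror_vars(2), of "mirror_map n" n]
    imageI[OF Pol_mirror_vars(3), of i n "mirror_map n"]
  by (simp_all only: mirror_map_explicit simp_thms)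

lemma image_diagonal_monomial:
  "p \<le> n * c \<Longrightarrow> (uvar * vvar) ^ p * wvar ^ c \<in> mirror_map n ` Pol (n + 3)"
proof (induction c arbitrary: p)
  case 0
  have "mirror_map n 1 \<in> mirror_map n ` Pol (n + 3)" using Pol_one by (rule imageI)
  then show ?case using 0 by (simp add: m.map_one)
next
  case (Suc c)
  define i where "i = min p n"
  have i: "i \<le> n" "p - i \<le> n * c" "i + (p - i) = p" using Suc.prems by (auto simp: i_def)
  have "((uvar * vvar) ^ i * wvar) * ((uvar * vvar) ^ (p - i) * wvar ^ c) \<in> mirror_map n ` Pol (n + 3)"
    by (intro image_mult image_vars Suc.IH i)
  also have "((uvar * vvar) ^ i * wvar) * ((uvar * vvar) ^ (p - i) * wvar ^ c)
    = ((uvar * vvar) ^ i * (uvar * vvar) ^ (p - i)) * wvar ^ Suc c"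
    by (simp only: power_Suc mult_ac)
  also have "(uvar * vvar) ^ i * (uvar * vvar) ^ (p - i) = (uvar * vvar) ^ p"
    unfolding power_add[symmetric] i(3) ..
  finally show ?case .
qed

text \<open>One factor \<open>u\<^sup>2v\<close> at a time is traded for \<open>\<vartheta>\<^sub>1 - uv\<close>, where \<open>\<vartheta>\<^sub>1 = uv(1 + u)\<close>.\<close>

lemma image_upper_monomial:
  "p + q \<le> n * c \<Longrightarrow> (uvar * vvar) ^ p * (uvar * uvar * vvar) ^ q * wvar ^ c \<in> mirror_map n ` Pol (n + 3)"
proof (induction q arbitrary: p)
  case 0
  then show ?case using image_diagonal_monomial by simp
next
  case (Suc q)
  have "(uvar * vvar) ^ p * (uvar * uvar * vvar) ^ q * wvar ^ c * (uvar * vvar * (1 + uvar))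
      - (uvar * vvar) ^ Suc p * (uvar * uvar * vvar) ^ q * wvar ^ c \<in> mirror_map n ` Pol (n + 3)"
    using Suc.prems by (intro image_diff image_mult[OF _ image_vars(1)] Suc.IH) auto
  then show ?case by (simp add: algebra_simps)
qed

text \<open>Likewise with \<open>v = \<vartheta>\<^sub>2 - uv\<close>, where \<open>\<vartheta>\<^sub>2 = v(1 + u)\<close>.\<close>

lemma image_lower_monomial:
  "p + q \<le> n * c \<Longrightarrow> (uvar * vvar) ^ p * vvar ^ q * wvar ^ c \<in> mirror_map n ` Pol (n + 3)"
proof (induction q arbitrary: p)
  case 0
  then show ?case using image_diagonal_monomial by simp
next
  case (Suc q)
  have "(uvar * vvar) ^ p * vvar ^ q * wvar ^ c * (vvar * (1 + uvar))
      - (uvar * vvar) ^ Suc p * vvar ^ q * wvar ^ c \<in> mirror_map n ` Pol (n + 3)"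
    using Suc.prems by (intro image_diff image_mult[OF _ image_vars(2)] Suc.IH) auto
  then show ?case by (simp add: algebra_simps)
qed

text \<open>According to whether \<open>a \<ge> b\<close>, the monomial \<open>u\<^sup>a v\<^sup>b\<close> is a product of \<open>b\<close> factors \<open>uv\<close> and \<open>u\<^sup>2v\<close>, or of \<open>b\<close>
  factors \<open>uv\<close> and \<open>v\<close>.\<close>

lemma image_laurent_monomial:
  assumes "a \<le> 2 * b" "b \<le> n * c"
  shows "uvar ^ a * vvar ^ b * wvar ^ c \<in> mirror_map n ` Pol (n + 3)"
proof (cases "b \<le> a")
  case True
  define p q where "p = 2 * b - a" and "q = a - b"
  have pq: "p + 2 * q = a" "p + q = b" using True assms by (auto simp: p_def q_def)
  have "(uvar * vvar) ^ p * (uvar * uvar * vvar) ^ q * wvar ^ c \<in> mirror_map n ` Pol (n + 3)"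
    using assms pq by (intro image_upper_monomial) simp
  also have "(uvar * vvar) ^ p * (uvar * uvar * vvar) ^ q * wvar ^ c = uvar ^ (p + 2 * q) * vvar ^ (p + q) * wvar ^ c"
  proof -
    have "uvar ^ (p + 2 * q) = uvar ^ p * uvar ^ q * uvar ^ q"
      by (simp only: power_add mult_2 mult.assoc)
    then show ?thesis by (simp add: power_mult_distrib power_add mult_ac)
  qed
  finally show ?thesis by (simp only: pq)
next
  case False
  define q where "q = b - a"
  have q: "a + q = b" using False by (auto simp: q_def)
  have "(uvar * vvar) ^ a * vvar ^ q * wvar ^ c \<in> mirror_map n ` Pol (n + 3)"
    using assms q by (intro image_lower_monomial) simp
  also have "(uvar * vvar) ^ a * vvar ^ q * wvar ^ c = uvar ^ a * vvar ^ (a + q) * wvar ^ c"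
    by (simp add: power_mult_distrib power_add mult_ac)
  finally show ?thesis by (simp only: q)
qed

lemma theta_in_image:
  assumes "q \<in> sigma_points n"
  shows "theta n q \<in> mirror_map n ` Pol (n + 3)"
proof -
  obtain a' b' c' where q': "q = (a', b', c')" by (cases q)
  then have "0 \<le> a'" "0 \<le> b'" "0 \<le> c'" using assms by (auto simp: sigma_points_iff)
  then obtain a b c where q: "q = (int a, int b, int c)"
    unfolding q' by (metis nonneg_int_cases)
  have ab: "a \<le> 2 * b" "a \<le> b + n * c"
    using assms unfolding q sigma_points_iff by (auto simp flip: of_nat_mult of_nat_add)
  show ?thesis
  proof (cases "b \<le> n * c")
    case True
    then have "int b - int n * int c \<le> 0" by (simp flip: of_nat_mult)
    then have "theta n q = uvar ^ a * vvar ^ b * wvar ^ c"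
      by (simp add: q theta_def laurent_monom_powers)
    then show ?thesis using image_laurent_monomial[OF ab(1) True] by simp
  next
    case False
    define k where "k = b - n * c"
    \<comment> \<open>The factor \<open>(1 + u)\<^sup>k\<close> is absorbed by \<open>\<vartheta>\<^sub>1\<^sup>i \<vartheta>\<^sub>2\<^sup>k\<^sup>-\<^sup>i = u\<^sup>i v\<^sup>k (1 + u)\<^sup>k\<close>.  With this choice of \<open>i\<close> the remaining
      exponent of \<open>u\<close> lies between \<open>0\<close> and \<open>2nc\<close>, twice the remaining exponent \<open>nc\<close> of \<open>v\<close>.\<close>
    define i where "i = min a k"
    have k: "b = k + n * c" "k > 0" "int b - int n * int c = int k"
      using False by (auto simp: k_def of_nat_diff)
    have i: "a = i + (a - i)" "a - i \<le> 2 * (n * c)" "k = i + (k - i)"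
      using ab k(1) by (auto simp: i_def)
    have "theta n q = uvar ^ a * vvar ^ b * wvar ^ c * (1 + uvar) ^ k"
    proof -
      have "\<not> int b \<le> int n * int c" using k(2,3) by linarith
      then show ?thesis by (simp add: q theta_def laurent_monom_powers k(3))
    qed
    also have "\<dots> = uvar ^ (i + (a - i)) * (vvar ^ k * vvar ^ (n * c)) * wvar ^ c * (1 + uvar) ^ k"
      using i(1) k(1) by (simp add: power_add)
    also have "vvar ^ k = vvar ^ i * vvar ^ (k - i)" using i(3) by (metis power_add)
    also have "(1 + uvar) ^ k = (1 + uvar) ^ i * (1 + uvar) ^ (k - i)" using i(3) by (metis power_add)
    also have "uvar ^ (i + (a - i)) * (vvar ^ i * vvar ^ (k - i) * vvar ^ (n * c)) * wvar ^ c *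
        ((1 + uvar) ^ i * (1 + uvar) ^ (k - i)) =
      (uvar * vvar * (1 + uvar)) ^ i * (vvar * (1 + uvar)) ^ (k - i) *
        (uvar ^ (a - i) * vvar ^ (n * c) * wvar ^ c)"
      by (simp only: power_mult_distrib power_add mult_ac)
    also have "\<dots> \<in> mirror_map n ` Pol (n + 3)"
      using i(2) by (intro image_mult image_power image_vars image_laurent_monomial) auto
    finally show ?thesis .
  qed
qed

lemma mirror_map_image: "mirror_map n ` Pol (n + 3) = carrier (mirror_algebra n)"
proof
  let ?H = "range scalar \<union> theta n ` sigma_points n"
  let ?G = "generate_ring (ring_of_type_algebra :: laurent ring) ?H"
  have ring_simps: "monoid.mult (ring_of_type_algebra :: laurent ring) = (*)"
      "ring.add (ring_of_type_algebra :: laurent ring) = (+)"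
      "one (ring_of_type_algebra :: laurent ring) = 1"
    by (simp_all add: ring_of_type_algebra_def fun_eq_iff)
  have carr: "carrier (mirror_algebra n) = ?G" by (simp add: mirror_algebra_def)
  have one: "1 \<in> ?G" using generate_ring.one[of ring_of_type_algebra ?H] by (simp add: ring_simps)
  have mult: "f * g \<in> ?G" if "f \<in> ?G" "g \<in> ?G" for f g
    using generate_ring.eng_mult[OF that] by (simp add: ring_simps)
  have add: "f + g \<in> ?G" if "f \<in> ?G" "g \<in> ?G" for f g
    using generate_ring.eng_add[OF that] by (simp add: ring_simps)
  have scal: "scalar c \<in> ?G" for c by (rule generate_ring.incl) simp
  have zero: "0 \<in> ?G" using scal[of 0] by (simp add: scalar_def)
  have power: "f ^ k \<in> ?G" if "f \<in> ?G" for f k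
    by (induction k) (simp_all add: one mult that)
  have prod: "prod h A \<in> ?G" if "\<And>a. a \<in> A \<Longrightarrow> h a \<in> ?G" for h :: "nat \<Rightarrow> laurent" and A
    using that by (induction A rule: infinite_finite_induct) (simp_all add: one mult)
  have sum: "sum h A \<in> ?G" if "\<And>a. a \<in> A \<Longrightarrow> h a \<in> ?G" for h :: "(nat \<Rightarrow>\<^sub>0 nat) \<Rightarrow> laurent" and A
    using that by (induction A rule: infinite_finite_induct) (simp_all add: zero add)
  have gen: "theta n (theta_point n i) \<in> ?G" if "i \<in> {1..n + 3}" for i
  proof (rule generate_ring.incl, rule UnI2, rule imageI)
    show "theta_point n i \<in> sigma_points n"
      using that by (auto simp: theta_point_def sigma_points_iff)
  qed
  show "mirror_map n ` Pol (n + 3) \<subseteq> carrier (mirror_algebra n)"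
    unfolding carr
  proof (rule image_subsetI)
    fix f assume f: "f \<in> Pol (n + 3)"
    show "mirror_map n f \<in> ?G"
      unfolding mirror_map_def subst_def linear_extension_def
    proof (intro sum mult scal prod power gen)
      fix m i assume "m \<in> Poly_Mapping.keys f" "i \<in> Poly_Mapping.keys m"
      then show "i \<in> {1..n + 3}" using f unfolding Pol_iff by blast
    qed
  qed
  show "carrier (mirror_algebra n) \<subseteq> mirror_map n ` Pol (n + 3)"
    unfolding carr
  proof
    fix f assume "f \<in> ?G"
    then show "f \<in> mirror_map n ` Pol (n + 3)"
    proof (induction rule: generate_ring.induct)
      case one
      have "mirror_map n 1 \<in> mirror_map n ` Pol (n + 3)" using Pol_one by (rule imageI)
      then show ?case by (simp add: ring_simps m.map_one)
    next
      case (incl h)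
      have "scalar c \<in> mirror_map n ` Pol (n + 3)" for c
        using imageI[OF Pol_scalar, of "mirror_map n" c "n + 3"] by (simp add: mirror_map_scalar)
      then show ?case using incl theta_in_image by auto
    next
      case (a_inv h)
      interpret r: ring "ring_of_type_algebra :: laurent ring" by (rule ring_from_type_algebra)
      have "\<ominus>\<^bsub>ring_of_type_algebra\<^esub> h = - h"
        using r.minus_equality[of "- h" h] by (simp add: ring_of_type_algebra_def)
      then show ?case
        using a_inv.IH Pol_uminus by (auto simp flip: m.map_uminus)
    next
      case (eng_add f g)
      then show ?case using Pol_add by (auto simp: ring_simps simp flip: m.map_add)
    next
      case (eng_mult f g)
      then show ?case using image_mult by (simp add: ring_simps)
    qed
  qed
qed

end

lemma mirror_algebra_simps:
  "monoid.mult (mirror_algebra n) = (*)" "ring.add (mirror_algebra n) = (+)"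
  "one (mirror_algebra n) = 1" "ring.zero (mirror_algebra n) = 0"
  by (simp_all add: mirror_algebra_def ring_of_type_algebra_def fun_eq_iff)

lemma ring_mirror_algebra: "ring (mirror_algebra n)"
  unfolding mirror_algebra_def
  by (rule ring.generate_ring_is_ring[OF ring_from_type_algebra]) (simp add: ring_of_type_algebra_def)

lemma mirror_isomorphism:
  obtains h where "h \<in> ring_iso (polynomial_ring (n + 3) Quot minor_ideal n) (mirror_algebra n)"
    "\<And>f. f \<in> Pol (n + 3) \<Longrightarrow> h (minor_ideal n +>\<^bsub>polynomial_ring (n + 3)\<^esub> f) = mirror_map n f"
proof -
  interpret m: ring_morphism "mirror_map n" by (rule ring_morphism_mirror_map)
  interpret ring_hom_ring "polynomial_ring (n + 3)" "mirror_algebra n" "mirror_map n"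
  proof (rule ring_hom_ringI[OF ring_polynomial_ring ring_mirror_algebra])
    fix f assume "f \<in> Pol (n + 3)"
    then show "mirror_map n f \<in> carrier (mirror_algebra n)"
      unfolding mirror_map_image[symmetric] by (rule imageI)
  qed (simp_all add: mirror_algebra_simps m.map_simps)
  have "a_kernel (polynomial_ring (n + 3)) (mirror_algebra n) (mirror_map n) =
      {f \<in> Pol (n + 3). mirror_map n f = 0}"
    unfolding a_kernel_def' mirror_algebra_simps ..
  also have "\<dots> = minor_ideal n"
  proof
    show "{f \<in> Pol (n + 3). mirror_map n f = 0} \<subseteq> minor_ideal n"
      by (rule subsetI, elim CollectE conjE) (rule mirror_map_kernel_subset)
    show "minor_ideal n \<subseteq> {f \<in> Pol (n + 3). mirror_map n f = 0}"
      using minor_ideal_Pol[of n] by (intro subsetI CollectI conjI mirror_map_minor_ideal) auto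
  qed
  finally have ker: "a_kernel (polynomial_ring (n + 3)) (mirror_algebra n) (mirror_map n) = minor_ideal n" .
  show ?thesis
  proof (rule that)
    show "(\<lambda>A. the_elem (mirror_map n ` A)) \<in>
        ring_iso (polynomial_ring (n + 3) Quot minor_ideal n) (mirror_algebra n)"
      using FactRing_iso_set[OF mirror_map_image] unfolding ker .
    show "the_elem (mirror_map n ` (minor_ideal n +>\<^bsub>polynomial_ring (n + 3)\<^esub> f)) = mirror_map n f"
      if "f \<in> Pol (n + 3)" for f
      using the_elem_simp[OF that] unfolding ker .
  qed
qed


section \<open>The singular locus\<close>

lemma ring_morphism_const_poly: "ring_morphism (\<lambda>c::complex. [:c:])"
  by unfold_locales (simp_all add: one_pCons)

text \<open>The restriction of a polynomial to the line through \<open>p\<close> in the \<open>k\<close>-th coordinate direction.  Its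
  linear coefficient is the partial derivative at \<open>p\<close>, and unlike the latter it comes from a ring
  homomorphism, so that it can be studied on generators of an ideal.\<close>

definition line_restriction :: "(nat \<Rightarrow> complex) \<Rightarrow> nat \<Rightarrow> cpoly \<Rightarrow> complex poly"
  where "line_restriction p k = subst (\<lambda>c. [:c:]) (\<lambda>i. [:p i, if i = k then 1 else 0:])"

lemma coeff_1_linear_power: "coeff ([:a, 1:] ^ e) 1 = of_nat e * a ^ (e - 1)"
  for a :: "'a::{comm_ring_1, ring_char_0, semiring_no_zero_divisors}"
proof -
  have "coeff ([:a, 1:] ^ e) 1 = poly (pderiv ([:a, 1:] ^ e)) 0"
    by (simp add: poly_0_coeff_0 coeff_pderiv One_nat_def)
  then show ?thesis by (simp add: pderiv_power pderiv_pCons poly_power)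
qed

lemma eval_at_partial_deriv:
  "eval_at p (partial_deriv k f) = coeff (line_restriction p k f) 1"
proof -
  interpret e: ring_morphism "subst id p" by (rule ring_morphism_subst[OF ring_morphism_id])
  interpret i: complex_algebra "id :: complex \<Rightarrow> complex"
    unfolding complex_algebra_def by (rule ring_morphism_id)
  have mono: "of_nat (Poly_Mapping.lookup m k) * (\<Prod>i\<in>Poly_Mapping.keys (m - Poly_Mapping.single k 1).
        p i ^ Poly_Mapping.lookup (m - Poly_Mapping.single k 1) i) =
      coeff (\<Prod>i\<in>Poly_Mapping.keys m. [:p i, if i = k then 1 else 0:] ^ Poly_Mapping.lookup m i) 1"
    for m :: "nat \<Rightarrow>\<^sub>0 nat"
  proof -
    let ?A = "insert k (Poly_Mapping.keys m)"
    let ?r = "\<Prod>i\<in>?A - {k}. p i ^ Poly_Mapping.lookup m i"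
    have sub: "Poly_Mapping.keys (m - Poly_Mapping.single k 1) \<subseteq> ?A"
      by (auto simp: in_keys_iff lookup_minus)
    have "(\<Prod>i\<in>Poly_Mapping.keys (m - Poly_Mapping.single k 1).
        p i ^ Poly_Mapping.lookup (m - Poly_Mapping.single k 1) i)
      = (\<Prod>i\<in>?A. p i ^ Poly_Mapping.lookup (m - Poly_Mapping.single k 1) i)"
      by (rule monomial_value_superset[OF _ sub]) simp
    also have "\<dots> = p k ^ (Poly_Mapping.lookup m k - 1) *
        (\<Prod>i\<in>?A - {k}. p i ^ Poly_Mapping.lookup (m - Poly_Mapping.single k 1) i)"
      by (subst prod.remove[of _ k]) (simp_all add: lookup_minus)
    also have "(\<Prod>i\<in>?A - {k}. p i ^ Poly_Mapping.lookup (m - Poly_Mapping.single k 1) i) = ?r"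
      by (rule prod.cong) (auto simp: lookup_minus lookup_single when_def)
    finally have left: "(\<Prod>i\<in>Poly_Mapping.keys (m - Poly_Mapping.single k 1).
        p i ^ Poly_Mapping.lookup (m - Poly_Mapping.single k 1) i) = p k ^ (Poly_Mapping.lookup m k - 1) * ?r" .
    have "(\<Prod>i\<in>Poly_Mapping.keys m. [:p i, if i = k then 1 else 0:] ^ Poly_Mapping.lookup m i)
      = (\<Prod>i\<in>?A. [:p i, if i = k then 1 else 0:] ^ Poly_Mapping.lookup m i)"
      by (rule monomial_value_superset) auto
    also have "\<dots> = [:p k, 1:] ^ Poly_Mapping.lookup m k *
        (\<Prod>i\<in>?A - {k}. [:p i, if i = k then 1 else 0:] ^ Poly_Mapping.lookup m i)"
      by (subst prod.remove[of _ k]) simp_all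
    also have "(\<Prod>i\<in>?A - {k}. [:p i, if i = k then 1 else 0:] ^ Poly_Mapping.lookup m i) = [:?r:]"
    proof -
      interpret c: ring_morphism "\<lambda>c::complex. [:c:]" by (rule ring_morphism_const_poly)
      show ?thesis unfolding c.map_prod c.map_power by (rule prod.cong) auto
    qed
    finally have right: "(\<Prod>i\<in>Poly_Mapping.keys m. [:p i, if i = k then 1 else 0:] ^ Poly_Mapping.lookup m i)
      = [:p k, 1:] ^ Poly_Mapping.lookup m k * [:?r:]" .
    show ?thesis
      unfolding left right using coeff_1_linear_power[of "p k" "Poly_Mapping.lookup m k"]
      by (simp add: mult.commute)
  qed
  have "eval_at p (partial_deriv k f) = (\<Sum>m\<in>Poly_Mapping.keys f. Poly_Mapping.lookup f m *
      (of_nat (Poly_Mapping.lookup m k) * (\<Prod>i\<in>Poly_Mapping.keys (m - Poly_Mapping.single k 1).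
        p i ^ Poly_Mapping.lookup (m - Poly_Mapping.single k 1) i)))"
    unfolding eval_at_eq_subst partial_deriv_def e.map_sum
    by (rule sum.cong[OF refl]) (simp add: subst_def i.linear_extension_single mult_ac)
  also have "\<dots> = coeff (line_restriction p k f) 1"
    unfolding mono line_restriction_def subst_def linear_extension_def coeff_sum
    by (rule sum.cong) simp_all
  finally show ?thesis .
qed

definition axis_point :: "complex \<Rightarrow> nat \<Rightarrow> complex"
  where "axis_point t i = (if i = 3 then t else 0)"

lemma axis_point_zero_locus: "axis_point t \<in> zero_locus (n + 3) (minor_ideal n)"
proof -
  interpret e: ring_morphism "subst id (axis_point t)" by (rule ring_morphism_subst[OF ring_morphism_id])
  have v: "subst id (axis_point t) (pvar i) = axis_point t i" for i
    by (rule subst_pvar[OF ring_morphism_id])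
  have "eval_at (axis_point t) f = 0" if f: "f \<in> minor_ideal n" for f
    unfolding eval_at_eq_subst
    by (rule vanishes_on_minor_ideal[OF e.ring_morphism_axioms _ _ f])
      (simp_all add: e.map_simps v, simp_all add: axis_point_def)
  then show ?thesis by (auto simp: zero_locus_def affine_space_def axis_point_def)
qed

definition unit_vector :: "nat \<Rightarrow> nat \<Rightarrow> complex"
  where "unit_vector k i = (if i = k then 1 else 0)"

text \<open>On the line through the point in one of these directions, every minor vanishes to second order:
  all products in it are zero except \<open>z\<^sub>1 z\<^sub>1\<close>, in the direction of \<open>z\<^sub>1\<close>.\<close>

lemma unit_vector_tangent:
  assumes "n \<ge> 1" "k \<in> {1..4}"
  shows "unit_vector k \<in> tangent_space (n + 3) (minor_ideal n) (axis_point t)"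
proof -
  let ?D = "line_restriction (axis_point t) k"
  interpret D: ring_morphism ?D
    unfolding line_restriction_def by (rule ring_morphism_subst[OF ring_morphism_const_poly])
  have v: "?D (pvar i) = [:axis_point t i, if i = k then 1 else 0:]" for i
    unfolding line_restriction_def by (rule subst_pvar[OF ring_morphism_const_poly])
  have z: "\<exists>a. ?D (zvar i) = [:0, a:]" if "i \<ge> 1" for i
    using that by (simp add: v axis_point_def)
  have z0: "?D (zvar i) = 0" if "i \<ge> 2" for i
    using that assms(2) by (simp add: v axis_point_def)
  have zero: "coeff (?D f) 1 = 0" if f: "f \<in> minor_ideal n" for f
  proof -
    have "[:0, 0, 1:] dvd ?D f"
    proof (rule dvd_on_minor_ideal[OF D.ring_morphism_axioms _ f])
      fix f assume "f \<in> minors n"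
      then consider i where "i < n" "f = row_sum * zvar (Suc i) - zvar i * row_prod"
        | i j where "i < j" "j < n" "f = zvar i * zvar (Suc j) - zvar j * zvar (Suc i)"
        unfolding minors_iff by blast
      then show "[:0, 0, 1:] dvd ?D f"
      proof cases
        case 1
        have "?D row_prod = 0" by (simp add: D.map_simps v axis_point_def)
        moreover have "?D row_sum * ?D (zvar (Suc i)) = 0"
          by (auto simp: D.map_simps v axis_point_def)
        moreover have "?D f = ?D row_sum * ?D (zvar (Suc i)) - ?D (zvar i) * ?D row_prod"
          by (simp only: 1(2) D.map_diff D.map_mult[of row_sum] D.map_mult[of "zvar i"])
        ultimately have "?D f = 0" by (simp only: mult_zero_right diff_zero)
        then show ?thesis by simp
      next
        case 2
        obtain a where a: "?D (zvar j) = [:0, a:]" using z[of j] 2 by auto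
        obtain b where b: "?D (zvar (Suc i)) = [:0, b:]" using z[of "Suc i"] by auto
        have "?D f = - ([:0, a:] * [:0, b:])"
          unfolding 2(3) D.map_diff D.map_mult a b using z0[of "Suc j"] 2 by simp
        also have "\<dots> = [:0, 0, 1:] * [:- (a * b):]" by simp
        finally show ?thesis by (metis dvd_triv_left)
      qed
    qed
    then obtain q where "?D f = [:0, 0, 1:] * q" by (rule dvdE)
    then show ?thesis by (simp add: One_nat_def)
  qed
  have k: "k \<in> {1..n + 3}" using assms by auto
  have "(\<Sum>i = 1..n + 3. eval_at (axis_point t) (partial_deriv i f) * unit_vector k i) = 0"
    if f: "f \<in> minor_ideal n" for f
  proof -
    have "(\<Sum>i = 1..n + 3. eval_at (axis_point t) (partial_deriv i f) * unit_vector k i) =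
        (\<Sum>i = 1..n + 3. if i = k then eval_at (axis_point t) (partial_deriv i f) else 0)"
      by (rule sum.cong) (simp_all add: unit_vector_def)
    also have "\<dots> = eval_at (axis_point t) (partial_deriv k f)"
      using k by (simp add: sum.delta)
    also have "\<dots> = 0" unfolding eval_at_partial_deriv by (rule zero[OF f])
    finally show ?thesis .
  qed
  moreover have "unit_vector k \<in> affine_space (n + 3)"
    using k by (auto simp: affine_space_def unit_vector_def)
  ultimately show ?thesis by (simp add: tangent_space_def)
qed

text \<open>A basis of the tangent space is finite, because the tangent space lies in the span of the \<open>N\<close> unit
  vectors, and hence bounds the size of independent sets.\<close>

lemma card_le_tangent_dim:
  assumes "finite K" "\<And>k. k \<in> K \<Longrightarrow> unit_vector k \<in> tangent_space N I p"
  shows "card K \<le> tangent_dim N I p"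
proof -
  interpret V: vector_space "\<lambda>(c::complex) (v::nat \<Rightarrow> complex) i. c * v i"
    by unfold_locales (auto simp: fun_eq_iff algebra_simps)
  let ?T = "tangent_space N I p"
  have sum_apply: "(\<Sum>a\<in>A. h a) i = (\<Sum>a\<in>A. h a i)" for A and h :: "'a \<Rightarrow> nat \<Rightarrow> complex" and i
    by (induction A rule: infinite_finite_induct) simp_all
  obtain B where B: "B \<subseteq> ?T" "V.independent B" "?T \<subseteq> V.span B" "card B = V.dim ?T"
    by (rule V.basis_exists)
  have "?T \<subseteq> V.span (unit_vector ` {1..N})"
  proof
    fix v assume "v \<in> ?T"
    then have v: "v i = 0" if "i \<notin> {1..N}" for i
      using that by (auto simp: tangent_space_def affine_space_def)
    have "(\<Sum>k\<in>{1..N}. (\<lambda>i. v k * unit_vector k i)) \<in> V.span (unit_vector ` {1..N})"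
      by (intro V.span_sum V.span_scale V.span_base) simp
    moreover have "(\<Sum>k\<in>{1..N}. (\<lambda>i. v k * unit_vector k i)) = v"
    proof
      fix i
      have "(\<Sum>k\<in>{1..N}. (\<lambda>i. v k * unit_vector k i)) i = (\<Sum>k\<in>{1..N}. if k = i then v i else 0)"
        unfolding sum_apply by (rule sum.cong) (auto simp: unit_vector_def)
      also have "\<dots> = v i"
      proof (cases "i \<in> {1..N}")
        case True
        then show ?thesis by (simp add: sum.delta)
      next
        case False
        then show ?thesis using v[OF False] by (simp add: sum.delta')
      qed
      finally show "(\<Sum>k\<in>{1..N}. (\<lambda>i. v k * unit_vector k i)) i = v i" .
    qed
    ultimately show "v \<in> V.span (unit_vector ` {1..N})" by simp
  qed
  then have "B \<subseteq> V.span (unit_vector ` {1..N})" using B(1) by blast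
  then have "finite B" using V.independent_span_bound[OF _ B(2)] by blast
  have inj: "inj_on unit_vector K"
    by (rule inj_onI) (metis unit_vector_def zero_neq_one)
  have indep: "V.independent (unit_vector ` K)"
  proof
    assume "V.dependent (unit_vector ` K)"
    then obtain S u w where S: "finite S" "S \<subseteq> unit_vector ` K" "(\<Sum>v\<in>S. (\<lambda>i. u v * v i)) = 0"
        "w \<in> S" "u w \<noteq> 0"
      unfolding V.dependent_explicit by blast
    then obtain k where k: "w = unit_vector k" by blast
    have "0 = (\<Sum>v\<in>S. (\<lambda>i. u v * v i)) k" by (simp add: S(3))
    also have "\<dots> = (\<Sum>v\<in>S. if v = w then u w else 0)"
      unfolding sum_apply
    proof (rule sum.cong[OF refl])
      fix v assume "v \<in> S"
      then obtain j where "v = unit_vector j" using S(2) by blast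
      then show "u v * v k = (if v = w then u w else 0)"
      proof (cases "j = k")
        case True
        then show ?thesis using k \<open>v = _\<close> by (simp add: unit_vector_def)
      next
        case False
        then have "v k \<noteq> w k" using k \<open>v = _\<close> by (simp add: unit_vector_def)
        moreover have "v k = 0" using False \<open>v = _\<close> by (simp add: unit_vector_def)
        ultimately show ?thesis by auto
      qed
    qed
    also have "\<dots> = u w" using S(1,4) by (simp add: sum.delta')
    finally show False using S(5) by simp
  qed
  have "unit_vector ` K \<subseteq> V.span B" using assms(2) B(3) by blast
  then have "card (unit_vector ` K) \<le> card B"
    using V.independent_span_bound[OF \<open>finite B\<close> indep] by blast
  then show ?thesis using card_image[OF inj] B(4) by (simp add: tangent_dim_def)
qed

lemma axis_point_singular:
  assumes "n \<ge> 1"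
  shows "axis_point t \<in> singular_locus (n + 3) (minor_ideal n)"
proof -
  have "card {1..4::nat} \<le> tangent_dim (n + 3) (minor_ideal n) (axis_point t)"
    by (rule card_le_tangent_dim) (use unit_vector_tangent[OF assms] in auto)
  then have tangent: "4 \<le> tangent_dim (n + 3) (minor_ideal n) (axis_point t)" by simp
  have "local_dim (n + 3) (minor_ideal n) (axis_point t) \<le> 3"
    unfolding local_dim_def by (rule order_trans[OF prime_height_le_krull_dim]) (simp add: mirror_krull_dim)
  then have "enat (tangent_dim (n + 3) (minor_ideal n) (axis_point t)) \<noteq> local_dim (n + 3) (minor_ideal n) (axis_point t)"
  proof (intro notI)
    assume "enat (tangent_dim (n + 3) (minor_ideal n) (axis_point t)) = local_dim (n + 3) (minor_ideal n) (axis_point t)"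
    with \<open>local_dim _ _ _ \<le> 3\<close> have "enat (tangent_dim (n + 3) (minor_ideal n) (axis_point t)) \<le> enat 3"
      by (simp add: numeral_eq_enat)
    then show False using tangent by simp
  qed
  then show ?thesis
    using axis_point_zero_locus by (simp add: singular_locus_def)
qed

text \<open>The singular locus contains the \<open>z\<^sub>0\<close>-axis.  A polynomial that does not vanish at the origin has only
  finitely many zeros on this axis, so every Zariski neighbourhood of the origin contains other
  points of it.\<close>

lemma origin_nonisolated_singularity:
  assumes "n \<ge> 1"
  shows "nonisolated_singularity (n + 3) (minor_ideal n) 0"
proof -
  have origin: "axis_point 0 = 0" by (simp add: fun_eq_iff axis_point_def)
  have "\<not> isolated_singularity (n + 3) (minor_ideal n) 0"
  proof
    assume "isolated_singularity (n + 3) (minor_ideal n) 0"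
    then obtain S where S: "0 \<notin> zero_locus (n + 3) S"
        "singular_locus (n + 3) (minor_ideal n) - zero_locus (n + 3) S = {0}"
      by (auto simp: isolated_singularity_def)
    then obtain f where f: "f \<in> S" "eval_at 0 f \<noteq> 0"
      by (auto simp: zero_locus_def affine_space_def)
    define Q where "Q = subst (\<lambda>c. [:c:]) (\<lambda>i. if i = 3 then [:0, 1:] else 0) f"
    have Q: "poly Q t = eval_at (axis_point t) f" for t
    proof -
      have "ring_morphism (\<lambda>q::complex poly. poly q t)" by unfold_locales simp_all
      from subst_comp[OF this, of "\<lambda>c. [:c:]" "\<lambda>i. if i = 3 then [:0, 1:] else 0" f]
      have "poly Q t = subst ((\<lambda>q. poly q t) \<circ> (\<lambda>c. [:c:]))
          ((\<lambda>q. poly q t) \<circ> (\<lambda>i. if i = 3 then [:0, 1:] else 0)) f"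
        by (simp only: Q_def)
      also have "(\<lambda>q. poly q t) \<circ> (\<lambda>c. [:c:]) = id" by (simp add: fun_eq_iff)
      also have "(\<lambda>q. poly q t) \<circ> (\<lambda>i. if i = 3 then [:0, 1:] else 0) = axis_point t"
        by (simp add: fun_eq_iff axis_point_def)
      finally show ?thesis by (simp only: eval_at_eq_subst)
    qed
    have "Q \<noteq> 0" using Q[of 0] f(2) by (auto simp: origin)
    then have "finite (insert 0 {t. poly Q t = 0})" by (simp add: poly_roots_finite)
    then obtain t where t: "t \<noteq> 0" "poly Q t \<noteq> 0"
      using ex_new_if_finite[OF infinite_UNIV_char_0[where 'a = complex]] by blast
    then have "axis_point t \<notin> zero_locus (n + 3) S"
      using f(1) Q by (auto simp: zero_locus_def)
    then have "axis_point t = 0" using S(2) axis_point_singular[OF assms, of t] by blast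
    then show False using t(1) by (metis axis_point_def zero_fun_apply)
  qed
  then show ?thesis
    using axis_point_singular[OF assms, of 0] by (simp add: nonisolated_singularity_def origin)
qed


theorem theorem5p2:
  fixes n :: nat
  assumes "n \<ge> 1"
  shows "(\<exists>h \<in> ring_iso (polynomial_ring (n + 3) Quot minor_ideal n) (mirror_algebra n).
            (\<forall>c. h (minor_ideal n +>\<^bsub>polynomial_ring (n + 3)\<^esub> scalar c) = scalar c)
          \<and> h (minor_ideal n +>\<^bsub>polynomial_ring (n + 3)\<^esub> pvar 1) = theta n (1, 1, 0)
          \<and> h (minor_ideal n +>\<^bsub>polynomial_ring (n + 3)\<^esub> pvar 2) = theta n (0, 1, 0)
          \<and> h (minor_ideal n +>\<^bsub>polynomial_ring (n + 3)\<^esub> pvar 3) = theta n (0, 0, 1)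
          \<and> (\<forall>i\<in>{1..n}. h (minor_ideal n +>\<^bsub>polynomial_ring (n + 3)\<^esub> pvar (i + 3))
                          = theta n (int i, int i, 1)))
       \<and> ideal_codim (polynomial_ring (n + 3)) (minor_ideal n) = enat n
       \<and> domain (polynomial_ring (n + 3) Quot minor_ideal n)
       \<and> krull_dim (polynomial_ring (n + 3) Quot minor_ideal n) = 3
       \<and> nonisolated_singularity (n + 3) (minor_ideal n) 0"
proof (intro conjI)
  obtain h where h: "h \<in> ring_iso (polynomial_ring (n + 3) Quot minor_ideal n) (mirror_algebra n)"
    "\<And>f. f \<in> Pol (n + 3) \<Longrightarrow> h (minor_ideal n +>\<^bsub>polynomial_ring (n + 3)\<^esub> f) = mirror_map n f"
    using mirror_isomorphism by blast
  have var: "h (minor_ideal n +>\<^bsub>polynomial_ring (n + 3)\<^esub> pvar i) = theta n (theta_point n i)"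
    if "i \<in> {1..n + 3}" for i
    using h(2)[OF Pol_pvar[OF that]] by (simp only: mirror_map_pvar)
  show "\<exists>h \<in> ring_iso (polynomial_ring (n + 3) Quot minor_ideal n) (mirror_algebra n).
            (\<forall>c. h (minor_ideal n +>\<^bsub>polynomial_ring (n + 3)\<^esub> scalar c) = scalar c)
          \<and> h (minor_ideal n +>\<^bsub>polynomial_ring (n + 3)\<^esub> pvar 1) = theta n (1, 1, 0)
          \<and> h (minor_ideal n +>\<^bsub>polynomial_ring (n + 3)\<^esub> pvar 2) = theta n (0, 1, 0)
          \<and> h (minor_ideal n +>\<^bsub>polynomial_ring (n + 3)\<^esub> pvar 3) = theta n (0, 0, 1)
          \<and> (\<forall>i\<in>{1..n}. h (minor_ideal n +>\<^bsub>polynomial_ring (n + 3)\<^esub> pvar (i + 3))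
                          = theta n (int i, int i, 1))"
    by (intro bexI[OF _ h(1)] conjI allI ballI)
      (simp_all add: var h(2)[OF Pol_scalar] mirror_map_scalar theta_point_def)
qed (rule minor_ideal_codim domain_mirror_coordinate_ring mirror_krull_dim
      origin_nonisolated_singularity[OF assms])+

end
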